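(* Let $\mathcal R\subseteq\mathbb B$ be an operator subsystem and let $\dot{\mathcal R}=\pi_{\mathbb K}(\mathcal R)\subseteq\mathbb B/\mathbb K$, where $\mathrm C^*(\dot{\mathcal R})$ is separable. If the canonical embedding $\iota:\mathrm C^*(\dot{\mathcal R})\to\mathbb B/\mathbb K$ corresponds to an invertible element $[\iota]$ of $\mathrm{Ext}(\mathrm C^*(\dot{\mathcal R}))$, then $\mathcal R$ has the Smith-Ward property.
   Context: $\mathbb B$ is the C$^*$-algebra of bounded linear operators on the separable infinite-dimensional Hilbert space $\ell^2(\mathbb N)$, $\mathbb K$ is the ideal of compact operators, and $\pi_{\mathbb K}:\mathbb B\to\mathbb B/\mathbb K$ is the quotient map. An operator subsystem of a unital C$^*$-algebra $\mathcal A$ is a linear subspace that contains the identity and is closed under $x\mapsto x^*$; $\mathrm C^*(\mathcal R)$ denotes the C$^*$-subalgebra generated by $\mathcal R$. "ucp" means unital completely positive (and linear). Smith-Ward property: an operator subsystem $\mathcal R\subseteq\mathbb B$ has the Smith-Ward property if the identity embedding $\dot{\mathcal R}\to\mathbb B/\mathbb K$ has a ucp lift to $\mathbb B$, i.e. there is a ucp map $\psi:\dot{\mathcal R}\to\mathbb B$ with $\pi_{\mathbb K}(\psi(y))=y$ for all $y\in\dot{\mathcal R}$, where $\dot{\mathcal R}=\pi_{\mathbb K}(\mathcal R)$. Extensions: for a unital separable C$^*$-algebra $\mathcal A$, an extension of $\mathbb K$ by $\mathcal A$ is a unital $*$-monomorphism $\sigma:\mathcal A\to\mathbb B/\mathbb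 K$. Two extensions $\sigma_1,\sigma_2$ are equivalent if there is a unitary $u\in\mathbb B$ with $\sigma_2(a)=\pi_{\mathbb K}(u)\sigma_1(a)\pi_{\mathbb K}(u)^*$ for all $a$. $\mathrm{Ext}(\mathcal A)$ is the set of equivalence classes $[\sigma]$; it is an additive semigroup under the direct sum of extensions (using an identification $\ell^2(\mathbb N)\oplus\ell^2(\mathbb N)\cong\ell^2(\mathbb N)$), whose neutral element is the class of those extensions that lift to a unital $*$-homomorphism $\mathcal A\to\mathbb B$. *)

theory Defs
  imports "HOL-Analysis.Analysis"
begin

class complex_vector = real_vector +
  fixes scaleC :: "complex \<Rightarrow> 'a \<Rightarrow> 'a"  (infixr \<open>*\<^sub>C\<close> 75)
  assumes scaleC_add_right: "c *\<^sub>C (x + y) = c *\<^sub>C x + c *\<^sub>C y"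
    and scaleC_add_left: "(c + d) *\<^sub>C x = c *\<^sub>C x + d *\<^sub>C x"
    and scaleC_scaleC: "c *\<^sub>C d *\<^sub>C x = (c * d) *\<^sub>C x"
    and scaleR_scaleC: "r *\<^sub>R x = complex_of_real r *\<^sub>C x"

lemma scaleC_one [simp]: "1 *\<^sub>C x = (x :: 'a :: complex_vector)"
  using scaleR_scaleC[of 1 x] by simp

class complex_normed_vector = complex_vector + real_normed_vector +
  assumes norm_scaleC: "norm (c *\<^sub>C x) = cmod c * norm x"

typedef ell2 = "{x :: nat \<Rightarrow> complex. summable (\<lambda>n. (cmod (x n))\<^sup>2)}"
  morphisms coord Abs_ell2
  by (rule exI[of _ "\<lambda>_. 0"]) simp

setup_lifting type_definition_ell2

lemma ell2_summable_mult:
  fixes x y :: "nat \<Rightarrow> complex"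
  assumes "summable (\<lambda>n. (cmod (x n))\<^sup>2)" "summable (\<lambda>n. (cmod (y n))\<^sup>2)"
  shows "summable (\<lambda>n. cmod (x n) * cmod (y n))"
proof (rule summable_comparison_test')
  show "summable (\<lambda>n. (cmod (x n))\<^sup>2 + (cmod (y n))\<^sup>2)"
    using assms by (rule summable_add)
  show "norm (cmod (x n) * cmod (y n)) \<le> (cmod (x n))\<^sup>2 + (cmod (y n))\<^sup>2" for n
  proof -
    have "2 * (cmod (x n) * cmod (y n)) \<le> (cmod (x n))\<^sup>2 + (cmod (y n))\<^sup>2"
      using sum_squares_bound[of "cmod (x n)" "cmod (y n)"] by (simp add: mult.assoc)
    moreover have "0 \<le> cmod (x n) * cmod (y n)" by simp
    ultimately show ?thesis unfolding real_norm_def by linarith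
  qed
qed

lemma ell2_summable_add:
  fixes x y :: "nat \<Rightarrow> complex"
  assumes "summable (\<lambda>n. (cmod (x n))\<^sup>2)" "summable (\<lambda>n. (cmod (y n))\<^sup>2)"
  shows "summable (\<lambda>n. (cmod (x n + y n))\<^sup>2)"
proof (rule summable_comparison_test')
  show "summable (\<lambda>n. (cmod (x n))\<^sup>2 + (cmod (y n))\<^sup>2 + 2 * (cmod (x n) * cmod (y n)))"
    by (intro summable_add summable_mult assms ell2_summable_mult)
  show "norm ((cmod (x n + y n))\<^sup>2) \<le> (cmod (x n))\<^sup>2 + (cmod (y n))\<^sup>2 + 2 * (cmod (x n) * cmod (y n))" for n
  proof -
    have "(cmod (x n + y n))\<^sup>2 \<le> (cmod (x n) + cmod (y n))\<^sup>2"
      by (intro power_mono norm_triangle_ineq) simp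
    then show ?thesis by (simp add: power2_sum)
  qed
qed

lemma ell2_summable_scale:
  fixes x :: "nat \<Rightarrow> complex"
  assumes "summable (\<lambda>n. (cmod (x n))\<^sup>2)"
  shows "summable (\<lambda>n. (cmod (c * x n))\<^sup>2)"
  using summable_mult[OF assms, of "(cmod c)\<^sup>2"] by (simp add: norm_mult power_mult_distrib)

instantiation ell2 :: complex_vector
begin

lift_definition zero_ell2 :: ell2 is "\<lambda>_. 0" by simp
lift_definition plus_ell2 :: "ell2 \<Rightarrow> ell2 \<Rightarrow> ell2" is "\<lambda>x y n. x n + y n"
  by (rule ell2_summable_add)
lift_definition uminus_ell2 :: "ell2 \<Rightarrow> ell2" is "\<lambda>x n. - x n" by simp
lift_definition minus_ell2 :: "ell2 \<Rightarrow> ell2 \<Rightarrow> ell2" is "\<lambda>x y n. x n - y n"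
  using ell2_summable_add[of _ "\<lambda>n. - _ n"] by fastforce
lift_definition scaleC_ell2 :: "complex \<Rightarrow> ell2 \<Rightarrow> ell2" is "\<lambda>c x n. c * x n"
  by (rule ell2_summable_scale)
lift_definition scaleR_ell2 :: "real \<Rightarrow> ell2 \<Rightarrow> ell2" is "\<lambda>r x n. complex_of_real r * x n"
  by (rule ell2_summable_scale)

instance
  by (intro_classes; transfer; auto simp: fun_eq_iff algebra_simps)

end

lemma summable_ell2: "summable (\<lambda>n. (cmod (coord x n))\<^sup>2)"
  using coord[of x] by simp

lemmas coord_simps [simp] =
  zero_ell2.rep_eq plus_ell2.rep_eq uminus_ell2.rep_eq minus_ell2.rep_eq
  scaleC_ell2.rep_eq scaleR_ell2.rep_eq

lemma ell2_eqI: "(\<And>n. coord x n = coord y n) \<Longrightarrow> x = y"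
  by (metis coord_inject ext)

definition cinner :: "ell2 \<Rightarrow> ell2 \<Rightarrow> complex"
  where "cinner x y = (\<Sum>n. cnj (coord x n) * coord y n)"

lemma cinner_sums: "(\<lambda>n. cnj (coord x n) * coord y n) sums cinner x y"
  unfolding cinner_def
proof (rule summable_sums, rule summable_norm_cancel)
  show "summable (\<lambda>n. norm (cnj (coord x n) * coord y n))"
    using ell2_summable_mult[OF summable_ell2 summable_ell2, of x y] by (simp add: norm_mult)
qed

lemma cinner_add_right: "cinner x (y + z) = cinner x y + cinner x z"
  using sums_add[OF cinner_sums[of x y] cinner_sums[of x z]] cinner_sums[of x "y + z"]
  by (auto intro: sums_unique2 simp: algebra_simps)

lemma cinner_scaleC_right: "cinner x (c *\<^sub>C y) = c * cinner x y"
  using sums_mult[OF cinner_sums[of x y], of c] cinner_sums[of x "c *\<^sub>C y"]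
  by (auto intro: sums_unique2 simp: algebra_simps)

lemma cinner_commute: "cinner x y = cnj (cinner y x)"
proof -
  have "(\<lambda>n. cnj (cnj (coord y n) * coord x n)) sums cnj (cinner y x)"
    using cinner_sums[of y x] by (simp only: sums_cnj)
  then show ?thesis
    using cinner_sums[of x y] by (auto intro: sums_unique2 simp: mult.commute)
qed

lemma cinner_add_left: "cinner (x + y) z = cinner x z + cinner y z"
  by (metis cinner_commute cinner_add_right complex_cnj_add)

lemma cinner_scaleC_left: "cinner (c *\<^sub>C x) y = cnj c * cinner x y"
  by (metis cinner_commute cinner_scaleC_right complex_cnj_mult)

lemma cinner_self_sums: "(\<lambda>n. (cmod (coord x n))\<^sup>2) sums Re (cinner x x)"
proof -
  have "Re (cnj z * z) = (cmod z)\<^sup>2" for z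
    unfolding cmod_power2 by (simp add: power2_eq_square)
  then show ?thesis
    using sums_Re[OF cinner_sums[of x x]] by simp
qed

lemma coord_sq_le: "(cmod (coord x n))\<^sup>2 \<le> Re (cinner x x)"
  using sum_le_suminf[OF summable_ell2[of x], of "{n}"] cinner_self_sums[of x]
  by (simp add: sums_iff)

instantiation ell2 :: real_inner
begin

definition inner_ell2 :: "ell2 \<Rightarrow> ell2 \<Rightarrow> real"
  where "inner_ell2 x y = Re (cinner x y)"
definition norm_ell2 :: "ell2 \<Rightarrow> real"
  where "norm_ell2 x = sqrt (inner x x)"
definition sgn_ell2 :: "ell2 \<Rightarrow> ell2"
  where "sgn_ell2 x = x /\<^sub>R norm x"
definition dist_ell2 :: "ell2 \<Rightarrow> ell2 \<Rightarrow> real"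
  where "dist_ell2 x y = norm (x - y)"
definition uniformity_ell2 :: "(ell2 \<times> ell2) filter"
  where "uniformity_ell2 = (INF e\<in>{0 <..}. principal {(x, y). dist x y < e})"
definition open_ell2 :: "ell2 set \<Rightarrow> bool"
  where "open_ell2 U \<longleftrightarrow> (\<forall>x\<in>U. eventually (\<lambda>(x', y). x' = x \<longrightarrow> y \<in> U) uniformity)"

instance
proof
  fix x y z :: ell2 and r :: real
  show "inner x y = inner y x"
    unfolding inner_ell2_def by (subst cinner_commute) simp
  show "inner (x + y) z = inner x z + inner y z"
    by (simp add: inner_ell2_def cinner_add_left)
  show "inner (r *\<^sub>R x) y = r * inner x y"
    by (simp add: inner_ell2_def scaleR_scaleC cinner_scaleC_left)
  show "0 \<le> inner x x"
    unfolding inner_ell2_def using coord_sq_le[of x 0] by (meson order_trans zero_le_power2)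
  show "inner x x = 0 \<longleftrightarrow> x = 0"
  proof
    assume "inner x x = 0"
    then have "(cmod (coord x n))\<^sup>2 \<le> 0" for n
      using coord_sq_le[of x n] by (simp add: inner_ell2_def)
    then show "x = 0" by (intro ell2_eqI) simp
  next
    assume "x = 0"
    then show "inner x x = 0" by (simp add: inner_ell2_def cinner_def)
  qed
qed (rule norm_ell2_def sgn_ell2_def dist_ell2_def uniformity_ell2_def open_ell2_def)+

end

lemma cinner_minus_right: "cinner x (- y) = - cinner x y"
proof -
  have "- y = (-1) *\<^sub>C y" by (rule ell2_eqI) simp
  then show ?thesis by (simp only: cinner_scaleC_right) simp
qed

lemma cinner_diff_right: "cinner x (y - z) = cinner x y - cinner x z"
  using cinner_add_right[of x y "- z"] by (simp add: cinner_minus_right)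

lemma cinner_diff_left: "cinner (x - y) z = cinner x z - cinner y z"
  by (metis cinner_commute cinner_diff_right complex_cnj_diff)

lemma cinner_self: "cinner x x = complex_of_real ((norm x)\<^sup>2)"
proof -
  have "Im (cinner x x) = 0"
  proof -
    have "Im (cinner x x) = - Im (cinner x x)"
      by (subst cinner_commute) simp
    then show ?thesis by linarith
  qed
  moreover have "Re (cinner x x) = (norm x)\<^sup>2"
    by (simp add: power2_norm_eq_inner inner_ell2_def)
  ultimately show ?thesis by (simp add: complex_eq_iff)
qed

lemma norm_ell2_sums: "(\<lambda>n. (cmod (coord x n))\<^sup>2) sums ((norm x)\<^sup>2)"
  using cinner_self_sums[of x] by (simp add: cinner_self)

lemma cmod_coord_le: "cmod (coord x n) \<le> norm x"
proof (rule power2_le_imp_le)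
  show "(cmod (coord x n))\<^sup>2 \<le> (norm x)\<^sup>2"
    using coord_sq_le[of x n] by (simp add: cinner_self)
qed simp

lemma sum_coord_le: "(\<Sum>k<n. (cmod (coord x k))\<^sup>2) \<le> (norm x)\<^sup>2"
  using sum_le_suminf[OF summable_ell2[of x], of "{..<n}"] norm_ell2_sums[of x]
  by (simp add: sums_iff)

lemma cinner_eqI: "(\<And>z. cinner x z = cinner y z) \<Longrightarrow> x = y"
proof -
  assume *: "\<And>z. cinner x z = cinner y z"
  have "cinner (x - y) (x - y) = 0" by (simp add: cinner_diff_left *)
  then show "x = y" by (simp add: cinner_self)
qed

instance ell2 :: complex_normed_vector
proof
  fix c :: complex and x :: ell2
  have "complex_of_real ((norm (c *\<^sub>C x))\<^sup>2) = (c * cnj c) * cinner x x"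
    by (simp only: cinner_self[symmetric] cinner_scaleC_left cinner_scaleC_right mult.commute mult.left_commute)
  also have "\<dots> = complex_of_real ((cmod c * norm x)\<^sup>2)"
    by (simp only: complex_norm_square[symmetric] cinner_self of_real_power of_real_mult power_mult_distrib)
  finally have "complex_of_real ((norm (c *\<^sub>C x))\<^sup>2) = complex_of_real ((cmod c * norm x)\<^sup>2)" .
  then have "(norm (c *\<^sub>C x))\<^sup>2 = (cmod c * norm x)\<^sup>2"
    by (simp only: of_real_eq_iff)
  then show "norm (c *\<^sub>C x) = cmod c * norm x"
    by (simp add: power2_eq_iff_nonneg)
qed

lemma cmod_cinner_le: "cmod (cinner x y) \<le> norm x * norm y"
proof (cases "cinner x y = 0")
  case False
  define c where "c = cnj (sgn (cinner x y))"
  have c: "cmod c = 1" using False by (simp add: c_def norm_sgn)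
  have "cinner x (c *\<^sub>C y) = cmod (cinner x y)"
  proof -
    have "cnj (sgn z) * z = cmod z" if "z \<noteq> 0" for z :: complex
    proof -
      have "cnj (sgn z) * z = (z * cnj z) / cmod z"
        by (simp add: sgn_eq mult.commute)
      also have "\<dots> = cmod z"
        using that by (simp only: complex_norm_square[symmetric]) (simp add: power2_eq_square)
      finally show ?thesis .
    qed
    then show ?thesis using False by (simp add: c_def cinner_scaleC_right)
  qed
  then have "cmod (cinner x y) = inner x (c *\<^sub>C y)" by (simp add: inner_ell2_def)
  also have "\<dots> \<le> norm x * norm (c *\<^sub>C y)" by (rule norm_cauchy_schwarz)
  finally show ?thesis by (simp add: norm_scaleC c)
qed simp

lemma ell2_of_bounded_sums:
  fixes f :: "nat \<Rightarrow> complex"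
  assumes "\<And>n. (\<Sum>k<n. (cmod (f k))\<^sup>2) \<le> B\<^sup>2" and "0 \<le> B"
  shows "\<exists>x. coord x = f \<and> norm x \<le> B"
proof -
  have s: "summable (\<lambda>n. (cmod (f n))\<^sup>2)"
    by (rule summableI_nonneg_bounded[where x = "B\<^sup>2"]) (use assms in auto)
  define x where "x = Abs_ell2 f"
  have x: "coord x = f" using s by (simp add: x_def Abs_ell2_inverse)
  have "(norm x)\<^sup>2 \<le> B\<^sup>2"
    using norm_ell2_sums[of x] suminf_le_const[OF s, of "B\<^sup>2"] assms(1) by (simp add: x sums_iff)
  then have "norm x \<le> B" using assms(2) by (rule power2_le_imp_le)
  with x show ?thesis by blast
qed

instance ell2 :: banach
proof
  fix X :: "nat \<Rightarrow> ell2"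
  assume X: "Cauchy X"
  have "Cauchy (\<lambda>m. coord (X m) n)" for n
  proof (rule CauchyI)
    fix e :: real assume "0 < e"
    then obtain M where M: "\<forall>m\<ge>M. \<forall>m'\<ge>M. norm (X m - X m') < e"
      using CauchyD[OF X \<open>0 < e\<close>] by blast
    have "norm (coord (X m) n - coord (X m') n) < e" if "m \<ge> M" "m' \<ge> M" for m m'
      using cmod_coord_le[of "X m - X m'" n] M that by (simp add: le_less_trans)
    then show "\<exists>M. \<forall>m\<ge>M. \<forall>m'\<ge>M. norm (coord (X m) n - coord (X m') n) < e" by blast
  qed
  then have "\<exists>l. (\<lambda>m. coord (X m) n) \<longlonglongrightarrow> l" for n
    by (simp add: Cauchy_convergent_iff convergent_def)
  then obtain l where l: "\<And>n. (\<lambda>m. coord (X m) n) \<longlonglongrightarrow> l n" by metis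
  have key: "\<exists>M. \<forall>m\<ge>M. \<exists>d. coord d = (\<lambda>n. coord (X m) n - l n) \<and> norm d \<le> e" if e: "0 < e" for e :: real
  proof -
    obtain M where M: "\<forall>m\<ge>M. \<forall>m'\<ge>M. norm (X m - X m') < e"
      using CauchyD[OF X e] by blast
    have "\<exists>d. coord d = (\<lambda>n. coord (X m) n - l n) \<and> norm d \<le> e" if m: "m \<ge> M" for m
    proof (rule ell2_of_bounded_sums)
      fix n
      show "(\<Sum>k<n. (cmod (coord (X m) k - l k))\<^sup>2) \<le> e\<^sup>2"
      proof (rule tendsto_upperbound)
        show "(\<lambda>m'. \<Sum>k<n. (cmod (coord (X m) k - coord (X m') k))\<^sup>2)
                \<longlonglongrightarrow> (\<Sum>k<n. (cmod (coord (X m) k - l k))\<^sup>2)"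
          by (intro tendsto_intros l)
        have "(\<Sum>k<n. (cmod (coord (X m) k - coord (X m') k))\<^sup>2) \<le> e\<^sup>2" if "m' \<ge> M" for m'
        proof -
          have "(\<Sum>k<n. (cmod (coord (X m - X m') k))\<^sup>2) \<le> (norm (X m - X m'))\<^sup>2"
            by (rule sum_coord_le)
          also have "\<dots> \<le> e\<^sup>2" using M m that by (intro power_mono) (auto intro: less_imp_le)
          finally show ?thesis by simp
        qed
        then show "\<forall>\<^sub>F m' in sequentially. (\<Sum>k<n. (cmod (coord (X m) k - coord (X m') k))\<^sup>2) \<le> e\<^sup>2"
          by (auto simp: eventually_sequentially)
      qed simp
    qed (use e in simp)
    then show ?thesis by blast
  qed
  obtain m d where d: "coord d = (\<lambda>n. coord (X m) n - l n)" using key[of 1] by auto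
  define L where "L = X m - d"
  have L: "coord L n = l n" for n by (simp add: L_def d)
  have "X \<longlonglongrightarrow> L"
  proof (rule LIMSEQ_I)
    fix e :: real assume e: "0 < e"
    then obtain M where M: "\<forall>m\<ge>M. \<exists>d. coord d = (\<lambda>n. coord (X m) n - l n) \<and> norm d \<le> e / 2"
      using key[of "e / 2"] by auto
    have "norm (X m - L) < e" if "m \<ge> M" for m
    proof -
      obtain d where "coord d = (\<lambda>n. coord (X m) n - l n)" "norm d \<le> e / 2" using M \<open>m \<ge> M\<close> by blast
      moreover from this have "X m - L = d" by (intro ell2_eqI) (simp add: L)
      ultimately show ?thesis using e by simp
    qed
    then show "\<exists>no. \<forall>m\<ge>no. norm (X m - L) < e" by blast
  qed
  then show "convergent X" by (auto simp: convergent_def)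
qed

lift_definition ket :: "nat \<Rightarrow> ell2" is "\<lambda>i n. if n = i then 1 else 0"
proof -
  fix i :: nat
  have "summable (\<lambda>n. if n = i then 1 else 0 :: real)" by simp
  moreover have "(\<lambda>n. (cmod (if n = i then 1 else 0))\<^sup>2) = (\<lambda>n. if n = i then 1 else 0 :: real)" by auto
  ultimately show "summable (\<lambda>n. (cmod (if n = i then 1 else 0))\<^sup>2)" by simp
qed

lemma cinner_ket: "cinner (ket i) x = coord x i"
proof -
  have "(\<lambda>n. cnj (coord (ket i) n) * coord x n) = (\<lambda>n. if n = i then coord x i else 0)"
    by (auto simp: ket.rep_eq)
  then show ?thesis
    using cinner_sums[of "ket i" x] sums_single[of i "\<lambda>_. coord x i"] sums_unique2 by fastforce
qed

lemma norm_ket [simp]: "norm (ket i) = 1"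
proof -
  have "complex_of_real ((norm (ket i))\<^sup>2) = 1"
    by (simp only: cinner_self[symmetric] cinner_ket) (simp add: ket.rep_eq)
  then have "(norm (ket i))\<^sup>2 = 1" by (simp only: of_real_eq_1_iff)
  then show ?thesis using norm_ge_zero[of "ket i"] by (auto simp add: power2_eq_1_iff)
qed

lift_definition trunc :: "nat \<Rightarrow> ell2 \<Rightarrow> ell2" is "\<lambda>n x k. if k < n then x k else 0"
proof -
  fix n and x :: "nat \<Rightarrow> complex"
  assume "summable (\<lambda>k. (cmod (x k))\<^sup>2)"
  then show "summable (\<lambda>k. (cmod (if k < n then x k else 0))\<^sup>2)"
    by (rule summable_comparison_test'[where N = 0]) auto
qed

lemma trunc_eq_sum: "trunc n x = (\<Sum>i<n. coord x i *\<^sub>C ket i)"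
proof (induction n)
  case 0
  show ?case by (intro ell2_eqI) (simp add: trunc.rep_eq)
next
  case (Suc n)
  have "trunc (Suc n) x = trunc n x + coord x n *\<^sub>C ket n"
    by (intro ell2_eqI) (auto simp: trunc.rep_eq ket.rep_eq less_Suc_eq)
  with Suc show ?case by simp
qed

lemma norm_trunc_sq: "(norm (trunc n x))\<^sup>2 = (\<Sum>k<n. (cmod (coord x k))\<^sup>2)"
proof -
  have "(\<lambda>k. (cmod (coord (trunc n x) k))\<^sup>2) sums (\<Sum>k<n. (cmod (coord (trunc n x) k))\<^sup>2)"
    by (rule sums_finite) (auto simp: trunc.rep_eq)
  then show ?thesis using norm_ell2_sums[of "trunc n x"] sums_unique2
    by (fastforce simp: trunc.rep_eq)
qed

lemma norm_tail_sq: "(norm (x - trunc n x))\<^sup>2 = (norm x)\<^sup>2 - (norm (trunc n x))\<^sup>2"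
proof -
  have "(\<lambda>k. (cmod (coord x k))\<^sup>2 - (cmod (coord (trunc n x) k))\<^sup>2) sums ((norm x)\<^sup>2 - (norm (trunc n x))\<^sup>2)"
    by (intro sums_diff norm_ell2_sums)
  moreover have "(\<lambda>k. (cmod (coord x k))\<^sup>2 - (cmod (coord (trunc n x) k))\<^sup>2) = (\<lambda>k. (cmod (coord (x - trunc n x) k))\<^sup>2)"
    by (auto simp: trunc.rep_eq)
  ultimately show ?thesis using norm_ell2_sums[of "x - trunc n x"] sums_unique2 by fastforce
qed

lemma norm_tail_le: "norm (x - trunc n x) \<le> norm x"
proof (rule power2_le_imp_le)
  show "(norm (x - trunc n x))\<^sup>2 \<le> (norm x)\<^sup>2"
    unfolding norm_tail_sq[of x n] using zero_le_power2[of "norm (trunc n x)"] by linarith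
qed simp

lemma trunc_tendsto: "(\<lambda>n. trunc n x) \<longlonglongrightarrow> x"
proof -
  have "(\<lambda>n. (norm x)\<^sup>2 - (norm (trunc n x))\<^sup>2) \<longlonglongrightarrow> (norm x)\<^sup>2 - (norm x)\<^sup>2"
    unfolding norm_trunc_sq using norm_ell2_sums[of x] by (intro tendsto_diff tendsto_const) (simp add: sums_def)
  then have "(\<lambda>n. sqrt ((norm (x - trunc n x))\<^sup>2)) \<longlonglongrightarrow> sqrt 0"
    by (intro tendsto_real_sqrt) (simp add: norm_tail_sq)
  then have "(\<lambda>n. norm (x - trunc n x)) \<longlonglongrightarrow> 0" by simp
  then have "(\<lambda>n. norm (trunc n x - x)) \<longlonglongrightarrow> 0" by (simp add: norm_minus_commute)
  then show ?thesis by (subst LIM_zero_iff[symmetric]) (rule tendsto_norm_zero_cancel)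
qed

lemma riesz_ell2:
  fixes f :: "ell2 \<Rightarrow> complex"
  assumes bl: "bounded_linear f" and c: "\<And>c x. f (c *\<^sub>C x) = c * f x"
  shows "\<exists>y. \<forall>x. f x = cinner y x"
proof -
  interpret bounded_linear f by fact
  obtain B where B: "0 \<le> B" "\<And>x. norm (f x) \<le> norm x * B" using nonneg_bounded by blast
  have f_trunc: "f (trunc n x) = (\<Sum>i<n. coord x i * f (ket i))" for n x
    by (simp add: trunc_eq_sum sum c)
  have "(\<Sum>k<n. (cmod (cnj (f (ket k))))\<^sup>2) \<le> B\<^sup>2" for n
  proof -
    define v where "v = (\<Sum>i<n. cnj (f (ket i)) *\<^sub>C ket i)"
    have v: "coord v k = (if k < n then cnj (f (ket k)) else 0)" for k
    proof -
      have "coord (\<Sum>i<m. cnj (f (ket i)) *\<^sub>C ket i) k = (if k < m then cnj (f (ket k)) else 0)" for m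
        by (induction m) (auto simp: ket.rep_eq less_Suc_eq)
      then show ?thesis by (simp add: v_def)
    qed
    have tv: "trunc n v = v" by (intro ell2_eqI) (simp add: trunc.rep_eq v)
    define s where "s = (\<Sum>k<n. (cmod (f (ket k)))\<^sup>2)"
    have s0: "0 \<le> s" by (simp add: s_def sum_nonneg)
    have nv: "(norm v)\<^sup>2 = s"
      using norm_trunc_sq[of n v] by (simp add: tv v s_def)
    have "f v = s"
      using f_trunc[of n v] unfolding tv s_def of_real_sum complex_norm_square
      by (simp add: v mult.commute)
    then have "s \<le> norm v * B" using B(2)[of v] s0 by simp
    then have "s\<^sup>2 \<le> (norm v * B)\<^sup>2" using s0 by (rule power_mono)
    then have "s * s \<le> s * B\<^sup>2" unfolding power_mult_distrib nv power2_eq_square[of s] .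
    then have "s \<le> B\<^sup>2" using s0 by (cases "s = 0") (auto simp: mult_le_cancel_left)
    then show ?thesis by (simp add: s_def)
  qed
  then obtain y where y: "coord y = (\<lambda>k. cnj (f (ket k)))"
    using ell2_of_bounded_sums[of "\<lambda>k. cnj (f (ket k))" B] B(1) by blast
  have "f x = cinner y x" for x
  proof -
    have "(\<lambda>n. f (trunc n x)) \<longlonglongrightarrow> f x" by (intro tendsto trunc_tendsto)
    then have "(\<lambda>k. f (ket k) * coord x k) sums f x"
      by (simp add: f_trunc sums_def mult.commute)
    then show ?thesis using cinner_sums[of y x] by (simp add: y sums_unique2)
  qed
  then show ?thesis by blast
qed

lifting_forget ell2.lifting

class cstar_algebra = complex_normed_vector + real_normed_algebra_1 + banach +
  fixes star :: "'a \<Rightarrow> 'a"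
  assumes mult_scaleC_left: "c *\<^sub>C x * y = c *\<^sub>C (x * y)"
    and mult_scaleC_right: "x * c *\<^sub>C y = c *\<^sub>C (x * y)"
    and star_star [simp]: "star (star x) = x"
    and star_add: "star (x + y) = star x + star y"
    and star_scaleC: "star (c *\<^sub>C x) = cnj c *\<^sub>C star x"
    and star_mult: "star (x * y) = star y * star x"
    and cstar_identity: "norm (star x * x) = (norm x)\<^sup>2"

text \<open>The C*-algebra of bounded operators on $\ell^2(\mathbb N)$.  The library's
  type of bounded linear maps is real linear, hence the extra condition.\<close>

typedef bop = "{T :: ell2 \<Rightarrow>\<^sub>L ell2. \<forall>c x. blinfun_apply T (c *\<^sub>C x) = c *\<^sub>C blinfun_apply T x}"
  morphisms blinfun_of_bop Abs_bop
  by (rule exI[of _ 0]) (simp add: zero_blinfun.rep_eq, simp add: ell2_eqI)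

setup_lifting type_definition_bop

lift_definition bop_apply :: "bop \<Rightarrow> ell2 \<Rightarrow> ell2" is blinfun_apply .

lemma bop_eqI: "(\<And>x. bop_apply S x = bop_apply T x) \<Longrightarrow> S = T"
  by transfer (rule blinfun_eqI)

lemma bop_apply_bounded_linear: "bounded_linear (bop_apply T)"
  by transfer (rule blinfun.bounded_linear_right)

lemma bop_apply_scaleC: "bop_apply T (c *\<^sub>C x) = c *\<^sub>C bop_apply T x"
  by transfer blast

lemma bop_apply_add: "bop_apply T (x + y) = bop_apply T x + bop_apply T y"
  using bop_apply_bounded_linear linear_add bounded_linear.linear by blast

lemma bop_apply_diff: "bop_apply T (x - y) = bop_apply T x - bop_apply T y"
  using bop_apply_bounded_linear linear_diff bounded_linear.linear by blast

lemma bop_apply_zero [simp]: "bop_apply T 0 = 0"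
  using bop_apply_bounded_linear linear_0 bounded_linear.linear by blast

lemma bop_exists:
  assumes "\<And>x y. f (x + y) = f x + f y" "\<And>c x. f (c *\<^sub>C x) = c *\<^sub>C f x"
    and "\<And>x. norm (f x) \<le> norm x * B"
  shows "\<exists>T. bop_apply T = f"
proof -
  have bl: "bounded_linear f"
    by (rule bounded_linear_intro[of _ B]) (use assms in \<open>auto simp: scaleR_scaleC\<close>)
  have "bop_apply (Abs_bop (Blinfun f)) = f"
    using assms(2) by (simp add: bop_apply.rep_eq Abs_bop_inverse bounded_linear_Blinfun_apply bl)
  then show ?thesis ..
qed

lemma bounded_linear_scaleC: "bounded_linear (\<lambda>x :: 'a :: complex_normed_vector. c *\<^sub>C x)"
  by (rule bounded_linear_intro[of _ "cmod c"])
     (simp_all add: scaleC_add_right scaleR_scaleC scaleC_scaleC norm_scaleC mult.commute)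

lemma blinfun_apply_Blinfun_scaleC:
  fixes T :: "'a :: real_normed_vector \<Rightarrow>\<^sub>L 'b :: complex_normed_vector"
  shows "blinfun_apply (Blinfun (\<lambda>x. c *\<^sub>C blinfun_apply T x)) = (\<lambda>x. c *\<^sub>C blinfun_apply T x)"
  using bounded_linear_compose[OF bounded_linear_scaleC blinfun.bounded_linear_right]
  by (rule bounded_linear_Blinfun_apply)

instantiation bop :: complex_vector
begin

lift_definition zero_bop :: bop is 0
  by (simp add: zero_blinfun.rep_eq, simp add: ell2_eqI)
lift_definition plus_bop :: "bop \<Rightarrow> bop \<Rightarrow> bop" is "(+)"
  by (simp add: blinfun.add_left scaleC_add_right)
lift_definition uminus_bop :: "bop \<Rightarrow> bop" is "uminus"
  by (simp add: blinfun.minus_left, simp add: ell2_eqI)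
lift_definition minus_bop :: "bop \<Rightarrow> bop \<Rightarrow> bop" is "(-)"
  by (simp add: blinfun.diff_left) (intro allI ell2_eqI, simp add: algebra_simps)
lift_definition scaleR_bop :: "real \<Rightarrow> bop \<Rightarrow> bop" is "(*\<^sub>R)"
  by (simp add: blinfun.scaleR_left scaleR_scaleC scaleC_scaleC mult.commute)
lift_definition scaleC_bop :: "complex \<Rightarrow> bop \<Rightarrow> bop"
  is "\<lambda>c T. Blinfun (\<lambda>x. c *\<^sub>C blinfun_apply T x)"
  by (simp add: blinfun_apply_Blinfun_scaleC scaleC_scaleC mult.commute)

lemma bop_apply_simps_bop:
  "bop_apply (S + T) x = bop_apply S x + bop_apply T x" "bop_apply (S - T) x = bop_apply S x - bop_apply T x"
  "bop_apply (- S) x = - bop_apply S x" "bop_apply (r *\<^sub>R S) x = r *\<^sub>R bop_apply S x" "bop_apply 0 x = 0"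
  "bop_apply (c *\<^sub>C S) x = c *\<^sub>C bop_apply S x"
  by (transfer; simp add: blinfun.add_left blinfun.diff_left blinfun.minus_left blinfun.scaleR_left
        blinfun_apply_Blinfun_scaleC)+

instance
  by (intro_classes; rule bop_eqI)
     (simp_all add: bop_apply_simps_bop scaleC_add_right scaleC_add_left scaleC_scaleC scaleR_scaleC)

end

lemmas bop_apply_simps [simp] = bop_apply_simps_bop

instantiation bop :: complex_normed_vector
begin

lift_definition norm_bop :: "bop \<Rightarrow> real" is norm .

definition sgn_bop :: "bop \<Rightarrow> bop"
  where "sgn_bop x = x /\<^sub>R norm x"
definition dist_bop :: "bop \<Rightarrow> bop \<Rightarrow> real"
  where "dist_bop x y = norm (x - y)"
definition uniformity_bop :: "(bop \<times> bop) filter"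
  where "uniformity_bop = (INF e\<in>{0 <..}. principal {(x, y). dist x y < e})"
definition open_bop :: "bop set \<Rightarrow> bool"
  where "open_bop U \<longleftrightarrow> (\<forall>x\<in>U. eventually (\<lambda>(x', y). x' = x \<longrightarrow> y \<in> U) uniformity)"

lemma norm_bop_apply_aux: "norm (bop_apply T x) \<le> norm T * norm x"
  by transfer (rule norm_blinfun)

lemma norm_bop_bound: "0 \<le> b \<Longrightarrow> (\<And>x. norm (bop_apply T x) \<le> b * norm x) \<Longrightarrow> norm T \<le> b"
  by transfer (rule norm_blinfun_bound)

lemma norm_bop_ge_0: "0 \<le> norm (T :: bop)"
  by transfer simp

instance
proof
  fix S T U :: bop and r s :: real and c d :: complex
  show "norm S = 0 \<longleftrightarrow> S = 0" "norm (S + T) \<le> norm S + norm T"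
    "norm (r *\<^sub>R S) = \<bar>r\<bar> * norm S"
    by (transfer; simp add: norm_triangle_ineq)+
  have le: "norm (c *\<^sub>C S) \<le> cmod c * norm S" for c and S :: bop
  proof (rule norm_bop_bound)
    show "0 \<le> cmod c * norm S" using norm_bop_ge_0[of S] by simp
    show "norm (bop_apply (c *\<^sub>C S) x) \<le> cmod c * norm S * norm x" for x
      using mult_left_mono[OF norm_bop_apply_aux[of S x], of "cmod c"]
      by (simp add: bop_apply_simps_bop norm_scaleC mult.assoc)
  qed
  show "norm (c *\<^sub>C S) = cmod c * norm S"
  proof (cases "c = 0")
    case True
    have "norm (c *\<^sub>C S) \<ge> 0" by (rule norm_bop_ge_0)
    then show ?thesis using le[of c S] True by simp
  next
    case False
    have "S = (1 / c) *\<^sub>C c *\<^sub>C S"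
      using False by (intro bop_eqI) (simp add: bop_apply_simps_bop scaleC_scaleC ell2_eqI)
    then have "norm S \<le> cmod (1 / c) * norm (c *\<^sub>C S)"
      using le[of "1 / c" "c *\<^sub>C S"] by simp
    then show ?thesis using le[of c S] False by (simp add: norm_divide field_simps)
  qed
qed (rule sgn_bop_def dist_bop_def uniformity_bop_def open_bop_def)+

end

lemma norm_bop_apply: "norm (bop_apply T x) \<le> norm T * norm x"
  by (rule norm_bop_apply_aux)

instance bop :: banach
proof
  fix X :: "nat \<Rightarrow> bop"
  assume X: "Cauchy X"
  have nd: "norm (blinfun_of_bop S - blinfun_of_bop T) = norm (S - T)" for S T
    by transfer simp
  have "Cauchy (\<lambda>n. blinfun_of_bop (X n))"
    using X unfolding Cauchy_def dist_norm nd .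
  then obtain L where L: "(\<lambda>n. blinfun_of_bop (X n)) \<longlonglongrightarrow> L"
    using Cauchy_convergent_iff convergent_def by blast
  have pt: "(\<lambda>n. bop_apply (X n) x) \<longlonglongrightarrow> blinfun_apply L x" for x
    unfolding bop_apply.rep_eq by (intro blinfun.tendsto L tendsto_const)
  have "blinfun_apply L (c *\<^sub>C x) = c *\<^sub>C blinfun_apply L x" for c x
  proof (rule LIMSEQ_unique[OF pt])
    show "(\<lambda>n. bop_apply (X n) (c *\<^sub>C x)) \<longlonglongrightarrow> c *\<^sub>C blinfun_apply L x"
      unfolding bop_apply_scaleC by (rule bounded_linear.tendsto[OF bounded_linear_scaleC pt])
  qed
  then have "blinfun_of_bop (Abs_bop L) = L" by (simp add: Abs_bop_inverse)
  then have "norm (X n - Abs_bop L) = norm (blinfun_of_bop (X n) - L)" for n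
    by (simp add: nd[symmetric])
  then have "X \<longlonglongrightarrow> Abs_bop L"
    using L unfolding LIMSEQ_iff by simp
  then show "convergent X" by (auto simp: convergent_def)
qed

lemma adjoint_exists: "\<exists>S. \<forall>x y. cinner (bop_apply S x) y = cinner x (bop_apply T y)"
proof -
  have "\<exists>z. \<forall>y. cinner x (bop_apply T y) = cinner z y" for x
  proof (rule riesz_ell2)
    show "bounded_linear (\<lambda>y. cinner x (bop_apply T y))"
    proof (rule bounded_linear_intro[of _ "norm x * norm T"])
      show "norm (cinner x (bop_apply T y)) \<le> norm y * (norm x * norm T)" for y
      proof -
        have "norm (cinner x (bop_apply T y)) \<le> norm x * norm (bop_apply T y)" by (rule cmod_cinner_le)
        also have "\<dots> \<le> norm x * (norm T * norm y)" by (intro mult_left_mono norm_bop_apply) simp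
        finally show ?thesis by (simp add: mult_ac)
      qed
    qed (simp_all add: bop_apply_add cinner_add_right scaleR_scaleC scaleR_conv_of_real bop_apply_scaleC cinner_scaleC_right)
    show "cinner x (bop_apply T (c *\<^sub>C y)) = c * cinner x (bop_apply T y)" for c y
      by (simp add: bop_apply_scaleC cinner_scaleC_right)
  qed
  then obtain g where g: "\<And>x y. cinner x (bop_apply T y) = cinner (g x) y" by metis
  have "\<exists>S. bop_apply S = g"
  proof (rule bop_exists)
    show "g (x + y) = g x + g y" for x y
      by (rule cinner_eqI) (simp add: g[symmetric] cinner_add_left)
    show "g (c *\<^sub>C x) = c *\<^sub>C g x" for c x
      by (rule cinner_eqI) (simp add: g[symmetric] cinner_scaleC_left)
    show "norm (g x) \<le> norm x * norm T" for x
    proof -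
      have "(norm (g x))\<^sup>2 = cmod (cinner (g x) (g x))" by (simp add: cinner_self norm_power)
      also have "\<dots> = cmod (cinner x (bop_apply T (g x)))" by (simp add: g)
      also have "\<dots> \<le> norm x * norm (bop_apply T (g x))" by (rule cmod_cinner_le)
      also have "\<dots> \<le> norm x * (norm T * norm (g x))" by (intro mult_left_mono norm_bop_apply) simp
      finally have "norm (g x) * norm (g x) \<le> norm (g x) * (norm x * norm T)"
        by (simp add: power2_eq_square mult_ac)
      then show ?thesis by (cases "norm (g x) = 0") (simp_all add: mult_le_cancel_left)
    qed
  qed
  then show ?thesis using g by metis
qed

instantiation bop :: cstar_algebra
begin

lift_definition one_bop :: bop is id_blinfun by simp
lift_definition times_bop :: "bop \<Rightarrow> bop \<Rightarrow> bop" is "(o\<^sub>L)" by simp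
definition star_bop :: "bop \<Rightarrow> bop"
  where "star T = (THE S. \<forall>x y. cinner (bop_apply S x) y = cinner x (bop_apply T y))"

lemma bop_apply_one_bop: "bop_apply 1 x = x" and bop_apply_times_bop: "bop_apply (S * T) x = bop_apply S (bop_apply T x)"
  by (transfer; simp)+

lemma cinner_star_bop: "cinner (bop_apply (star T) x) y = cinner x (bop_apply T y)"
proof -
  obtain S where S: "\<forall>x y. cinner (bop_apply S x) y = cinner x (bop_apply T y)"
    using adjoint_exists by blast
  have "\<forall>x y. cinner (bop_apply (star T) x) y = cinner x (bop_apply T y)"
    unfolding star_bop_def
    by (rule theI[where a = S]) (use S in \<open>auto intro!: bop_eqI cinner_eqI\<close>)
  then show ?thesis by blast
qed

lemma star_eqI_bop: "(\<And>x y. cinner (bop_apply S x) y = cinner x (bop_apply T y)) \<Longrightarrow> star T = S"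
  by (auto intro!: bop_eqI cinner_eqI simp: cinner_star_bop)

instance
proof
  fix S T U :: bop and r :: real and c :: complex
  show "S * T * U = S * (T * U)" "(S + T) * U = S * U + T * U" "S * (T + U) = S * T + S * U"
    "1 * S = S" "S * 1 = S"
    by (rule bop_eqI, simp add: bop_apply_times_bop bop_apply_one_bop bop_apply_add)+
  show "(0 :: bop) \<noteq> 1"
  proof
    assume "(0 :: bop) = 1"
    then have "bop_apply 0 (ket 0) = bop_apply 1 (ket 0)" by simp
    then have "norm (ket 0) = 0" by (simp add: bop_apply_one_bop)
    then show False by simp
  qed
  show "r *\<^sub>R S * T = r *\<^sub>R (S * T)" "S * r *\<^sub>R T = r *\<^sub>R (S * T)"
    "c *\<^sub>C S * T = c *\<^sub>C (S * T)" "S * c *\<^sub>C T = c *\<^sub>C (S * T)"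
    by (rule bop_eqI, simp add: bop_apply_times_bop scaleR_scaleC bop_apply_scaleC)+
  show nm: "norm (S * T) \<le> norm S * norm T" for S T :: bop
  proof (rule norm_bop_bound)
    fix x
    have "norm (bop_apply S (bop_apply T x)) \<le> norm S * norm (bop_apply T x)" by (rule norm_bop_apply)
    also have "\<dots> \<le> norm S * (norm T * norm x)" by (intro mult_left_mono norm_bop_apply) simp
    finally show "norm (bop_apply (S * T) x) \<le> norm S * norm T * norm x"
      by (simp add: bop_apply_times_bop mult.assoc)
  qed simp
  show "norm (1 :: bop) = 1"
  proof (rule antisym)
    show "norm (1 :: bop) \<le> 1" by (rule norm_bop_bound) (simp_all add: bop_apply_one_bop)
    show "1 \<le> norm (1 :: bop)" using norm_bop_apply[of 1 "ket 0"] by (simp add: bop_apply_one_bop)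
  qed
  show ss: "star (star T) = T" for T :: bop
    by (rule star_eqI_bop) (metis cinner_star_bop cinner_commute)
  show "star (S + T) = star S + star T" "star (c *\<^sub>C S) = cnj c *\<^sub>C star S"
    "star (S * T) = star T * star S"
    by (rule star_eqI_bop, simp add: cinner_star_bop cinner_add_left cinner_add_right
          cinner_scaleC_left cinner_scaleC_right bop_apply_times_bop)+
  have sq: "(norm T)\<^sup>2 \<le> norm (star T * T)" for T :: bop
  proof -
    have "norm T \<le> sqrt (norm (star T * T))"
    proof (rule norm_bop_bound)
      fix x
      have "(norm (bop_apply T x))\<^sup>2 = cmod (cinner (bop_apply T x) (bop_apply T x))" by (simp add: cinner_self norm_power)
      also have "\<dots> = cmod (cinner (bop_apply (star T * T) x) x)" by (simp add: bop_apply_times_bop cinner_star_bop)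
      also have "\<dots> \<le> norm (bop_apply (star T * T) x) * norm x" by (rule cmod_cinner_le)
      also have "\<dots> \<le> (norm (star T * T) * norm x) * norm x" by (intro mult_right_mono norm_bop_apply) simp
      also have "\<dots> = (sqrt (norm (star T * T)) * norm x)\<^sup>2"
        by (simp add: power_mult_distrib) (simp add: power2_eq_square)
      finally show "norm (bop_apply T x) \<le> sqrt (norm (star T * T)) * norm x"
        by (rule power2_le_imp_le) simp
    qed simp
    then have "(norm T)\<^sup>2 \<le> (sqrt (norm (star T * T)))\<^sup>2" by (intro power_mono) simp_all
    then show ?thesis by simp
  qed
  have le: "norm T \<le> norm (star T)" for T :: bop
  proof -
    have "norm T * norm T \<le> norm (star T) * norm T"
      using sq[of T] nm[of "star T" T] by (simp add: power2_eq_square)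
    then show ?thesis by (cases "norm T = 0") (auto simp: mult_le_cancel_right)
  qed
  have "norm (star T) = norm T" for T :: bop
    using le[of T] le[of "star T"] by (simp add: ss)
  then show "norm (star S * S) = (norm S)\<^sup>2"
    using sq[of S] nm[of "star S" S] by (simp add: power2_eq_square)
qed

end

lemmas bop_apply_one [simp] = bop_apply_one_bop
lemmas bop_apply_times [simp] = bop_apply_times_bop
lemmas cinner_star = cinner_star_bop
lemmas star_eqI = star_eqI_bop

lemma star_diff: "star (x - y) = star x - star (y :: 'a :: cstar_algebra)"
  using star_add[of "x - y" y] by (simp add: algebra_simps)

lemma star_one [simp]: "star 1 = (1 :: 'a :: cstar_algebra)"
  by (metis mult_1_left mult_1_right star_mult star_star)

lemma norm_star [simp]: "norm (star x) = norm (x :: 'a :: cstar_algebra)"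
proof -
  have le: "norm x \<le> norm (star x)" for x :: 'a
  proof -
    have "norm x * norm x \<le> norm (star x) * norm x"
      using cstar_identity[of x] norm_mult_ineq[of "star x" x] by (simp add: power2_eq_square)
    then show ?thesis by (cases "norm x = 0") (auto simp: mult_le_cancel_right)
  qed
  show ?thesis using le[of x] le[of "star x"] by simp
qed

lifting_forget bop.lifting

definition compact_op :: "bop \<Rightarrow> bool"
  where "compact_op T \<longleftrightarrow> compact (closure (bop_apply T ` cball 0 1))"

lemma compact_opI:
  assumes "compact K" "\<And>x. norm x \<le> 1 \<Longrightarrow> bop_apply T x \<in> K"
  shows "compact_op T"
proof -
  have "closure (bop_apply T ` cball 0 1) \<subseteq> K"
    using assms by (intro closure_minimal compact_imp_closed) auto
  then have "compact (K \<inter> closure (bop_apply T ` cball 0 1))"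
    using assms(1) by (intro compact_Int_closed) auto
  moreover have "K \<inter> closure (bop_apply T ` cball 0 1) = closure (bop_apply T ` cball 0 1)"
    using \<open>closure (bop_apply T ` cball 0 1) \<subseteq> K\<close> by blast
  ultimately show ?thesis unfolding compact_op_def by simp
qed

lemma compact_opD:
  assumes "compact_op T"
  shows "\<exists>K. compact K \<and> (\<forall>x. norm x \<le> 1 \<longrightarrow> bop_apply T x \<in> K)"
proof (intro exI conjI allI impI)
  show "compact (closure (bop_apply T ` cball 0 1))" using assms by (simp add: compact_op_def)
  show "norm x \<le> 1 \<Longrightarrow> bop_apply T x \<in> closure (bop_apply T ` cball 0 1)" for x
    by (rule subsetD[OF closure_subset]) auto
qed

lemma compact_op_zero [simp]: "compact_op 0"
  by (rule compact_opI[of "{0}"]) auto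

lemma compact_op_add:
  assumes "compact_op S" "compact_op T" shows "compact_op (S + T)"
proof -
  obtain K where K: "compact K" "\<And>x. norm x \<le> 1 \<Longrightarrow> bop_apply S x \<in> K" using compact_opD[OF assms(1)] by blast
  obtain L where L: "compact L" "\<And>x. norm x \<le> 1 \<Longrightarrow> bop_apply T x \<in> L" using compact_opD[OF assms(2)] by blast
  show ?thesis
    by (rule compact_opI[OF compact_sums[OF K(1) L(1)]]) (use K(2) L(2) in auto)
qed

lemma compact_op_mult_left:
  assumes "compact_op T" shows "compact_op (S * T)"
proof -
  obtain K where K: "compact K" "\<And>x. norm x \<le> 1 \<Longrightarrow> bop_apply T x \<in> K" using compact_opD[OF assms(1)] by blast
  have "continuous_on K (bop_apply S)" by (simp add: bop_apply_bounded_linear linear_continuous_on)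
  then have "compact (bop_apply S ` K)" using K(1) by (rule compact_continuous_image)
  then show ?thesis by (rule compact_opI) (use K(2) in auto)
qed

lemma compact_op_scaleC:
  assumes "compact_op T" shows "compact_op (c *\<^sub>C T)"
  using compact_op_mult_left[OF assms, of "c *\<^sub>C 1"] by (simp add: mult_scaleC_left)

lemma compact_op_mult_right:
  assumes "compact_op T" shows "compact_op (T * S)"
proof -
  obtain K where K: "compact K" "\<And>x. norm x \<le> 1 \<Longrightarrow> bop_apply T x \<in> K" using compact_opD[OF assms(1)] by blast
  define b where "b = norm S + 1"
  have b: "b > 0" by (simp add: b_def add_nonneg_pos)
  have cp: "compact ((\<lambda>y. complex_of_real b *\<^sub>C y) ` K)"
    using K(1) by (intro compact_continuous_image linear_continuous_on bounded_linear_scaleC)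
  show ?thesis
  proof (rule compact_opI[OF cp])
    fix x :: ell2 assume x: "norm x \<le> 1"
    have "norm (bop_apply S x) \<le> norm S * norm x" by (rule norm_bop_apply)
    also have "\<dots> \<le> norm S * 1" using x by (intro mult_left_mono) auto
    finally have le: "norm (bop_apply S x) \<le> b" by (simp add: b_def)
    define y where "y = complex_of_real (1 / b) *\<^sub>C bop_apply S x"
    have "norm y \<le> 1" using le b by (simp add: y_def norm_scaleC norm_divide divide_simps)
    then have "bop_apply T y \<in> K" by (rule K(2))
    moreover have "bop_apply (T * S) x = complex_of_real b *\<^sub>C bop_apply T y"
      using b by (simp add: y_def bop_apply_scaleC scaleC_scaleC)
    ultimately show "bop_apply (T * S) x \<in> (\<lambda>y. complex_of_real b *\<^sub>C y) ` K" by blast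
  qed
qed

lemma compact_op_minus: "compact_op T \<Longrightarrow> compact_op (- T)"
  using compact_op_mult_left[of T "- 1"] by simp

lemma compact_op_diff: "compact_op S \<Longrightarrow> compact_op T \<Longrightarrow> compact_op (S - T)"
  using compact_op_add[OF _ compact_op_minus] by fastforce

lemma compact_op_net:
  assumes "compact_op T" "0 < e"
  shows "\<exists>F. finite F \<and> (\<forall>x. norm x \<le> 1 \<longrightarrow> (\<exists>y\<in>F. norm (bop_apply T x - y) < e))"
proof -
  obtain K where K: "compact K" "\<And>x. norm x \<le> 1 \<Longrightarrow> bop_apply T x \<in> K" using compact_opD[OF assms(1)] by blast
  obtain F where F: "finite F" "K \<subseteq> (\<Union>x\<in>F. ball x e)"
    using K(1) assms(2) unfolding compact_eq_totally_bounded by blast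
  have "\<exists>y\<in>F. norm (bop_apply T x - y) < e" if "norm x \<le> 1" for x
    using subsetD[OF F(2) K(2)[OF that]] by (auto simp: dist_norm norm_minus_commute)
  with F(1) show ?thesis by blast
qed

lemma norm_le_ball:
  assumes "0 \<le> b" "\<And>x. norm x \<le> 1 \<Longrightarrow> norm (bop_apply T x) \<le> b"
  shows "norm T \<le> b"
proof (rule norm_bop_bound)
  fix x :: ell2
  show "norm (bop_apply T x) \<le> b * norm x"
  proof (cases "x = 0")
    case False
    define y where "y = complex_of_real (1 / norm x) *\<^sub>C x"
    have "norm y \<le> 1" using False by (simp add: y_def norm_scaleC norm_divide)
    then have "norm (bop_apply T y) \<le> b" by (rule assms(2))
    then show ?thesis using False by (simp add: y_def bop_apply_scaleC norm_scaleC norm_divide divide_simps)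
  qed simp
qed fact

lemma compact_op_closed: "closed (Collect compact_op)"
proof -
  have "compact_op T" if T: "\<And>e. 0 < e \<Longrightarrow> \<exists>S. compact_op S \<and> norm (T - S) < e" for T
  proof -
    have "\<exists>k. finite k \<and> closure (bop_apply T ` cball 0 1) \<subseteq> (\<Union>x\<in>k. ball x e)" if e: "0 < e" for e
    proof -
      obtain S where S: "compact_op S" "norm (T - S) < e / 3" using T[of "e / 3"] e by auto
      obtain F where F: "finite F" "\<And>x. norm x \<le> 1 \<Longrightarrow> \<exists>y\<in>F. norm (bop_apply S x - y) < e / 3"
        using compact_op_net[OF S(1), of "e / 3"] e by auto
      have "closure (bop_apply T ` cball 0 1) \<subseteq> (\<Union>x\<in>F. cball x (2 * e / 3))"
      proof (rule closure_minimal)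
        show "bop_apply T ` cball 0 1 \<subseteq> (\<Union>x\<in>F. cball x (2 * e / 3))"
        proof clarify
          fix x :: ell2 assume "x \<in> cball 0 1"
          then have x: "norm x \<le> 1" by simp
          obtain y where y: "y \<in> F" "norm (bop_apply S x - y) < e / 3" using F(2)[OF x] by blast
          have "norm (bop_apply (T - S) x) \<le> norm (T - S) * norm x" by (rule norm_bop_apply)
          also have "\<dots> \<le> norm (T - S) * 1" using x by (intro mult_left_mono) auto
          finally have "norm (bop_apply T x - bop_apply S x) < e / 3" using S(2) by simp
          moreover have "norm (bop_apply T x - y) \<le> norm (bop_apply T x - bop_apply S x) + norm (bop_apply S x - y)"
            using norm_triangle_ineq[of "bop_apply T x - bop_apply S x" "bop_apply S x - y"] by simp
          ultimately have "norm (bop_apply T x - y) \<le> 2 * e / 3" using y(2) by linarith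
          then show "bop_apply T x \<in> (\<Union>x\<in>F. cball x (2 * e / 3))"
            using y(1) by (auto simp: dist_norm norm_minus_commute)
        qed
        show "closed (\<Union>x\<in>F. cball x (2 * e / 3))" using F(1) by blast
      qed
      also have "\<dots> \<subseteq> (\<Union>x\<in>F. ball x e)" using e by force
      finally show ?thesis using F(1) by blast
    qed
    then show ?thesis
      unfolding compact_op_def compact_eq_totally_bounded by (simp add: complete_eq_closed)
  qed
  then have "x \<in> Collect compact_op" if "x \<in> closure (Collect compact_op)" for x
    using that unfolding closure_approachable by (metis dist_commute dist_norm mem_Collect_eq)
  then show ?thesis by (metis closure_subset closed_closure subsetI subset_antisym)
qed

definition coord_proj :: "nat \<Rightarrow> bop"
  where "coord_proj n = (SOME P. bop_apply P = trunc n)"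

lemma bop_apply_coord_proj [simp]: "bop_apply (coord_proj n) = trunc n"
proof -
  have "\<exists>P. bop_apply P = trunc n"
  proof (rule bop_exists)
    show "trunc n (x + y) = trunc n x + trunc n y" for x y
      by (rule ell2_eqI) (simp add: trunc.rep_eq)
    show "trunc n (c *\<^sub>C x) = c *\<^sub>C trunc n x" for c x
      by (rule ell2_eqI) (simp add: trunc.rep_eq)
    show "norm (trunc n x) \<le> norm x * 1" for x
    proof (rule power2_le_imp_le)
      show "(norm (trunc n x))\<^sup>2 \<le> (norm x * 1)\<^sup>2"
        using sum_coord_le[of x n] by (simp add: norm_trunc_sq)
    qed simp
  qed
  then show ?thesis unfolding coord_proj_def by (rule someI_ex)
qed

lemma star_coord_proj: "star (coord_proj n) = coord_proj n"
proof (rule star_eqI)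
  fix x y
  have "(\<lambda>k. cnj (coord (trunc n x) k) * coord y k) = (\<lambda>k. cnj (coord x k) * coord (trunc n y) k)"
    by (auto simp: trunc.rep_eq)
  then show "cinner (bop_apply (coord_proj n) x) y = cinner x (bop_apply (coord_proj n) y)"
    by (simp add: cinner_def)
qed

lemma norm_compl_proj: "norm (1 - coord_proj n) \<le> 1"
  by (rule norm_bop_bound) (simp_all add: norm_tail_le)

lemma compact_coord_proj: "compact_op (coord_proj n)"
proof -
  have "\<exists>K. compact K \<and> (\<forall>x. norm x \<le> 1 \<longrightarrow> trunc n x \<in> K)"
  proof (induction n)
    case 0
    then show ?case by (intro exI[of _ "{0}"]) (simp add: trunc_eq_sum)
  next
    case (Suc n)
    then obtain K where K: "compact K" "\<And>x. norm x \<le> 1 \<Longrightarrow> trunc n x \<in> K" by blast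
    have "bounded_linear (\<lambda>c :: complex. c *\<^sub>C ket n)"
      by (rule bounded_linear_intro[of _ 1])
         (simp_all add: scaleC_add_left scaleR_scaleC scaleC_scaleC norm_scaleC scaleR_conv_of_real)
    then have "compact ((\<lambda>c. c *\<^sub>C ket n) ` cball 0 1)"
      by (intro compact_continuous_image linear_continuous_on) auto
    then have "compact {x + y |x y. x \<in> K \<and> y \<in> (\<lambda>c. c *\<^sub>C ket n) ` cball 0 1}"
      by (rule compact_sums[OF K(1)])
    moreover have "trunc (Suc n) x \<in> {x + y |x y. x \<in> K \<and> y \<in> (\<lambda>c. c *\<^sub>C ket n) ` cball 0 1}"
      if "norm x \<le> 1" for x
    proof -
      have "cmod (coord x n) \<le> 1" using cmod_coord_le[of x n] that by simp
      then have "coord x n *\<^sub>C ket n \<in> (\<lambda>c. c *\<^sub>C ket n) ` cball 0 1" by auto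
      moreover have "trunc (Suc n) x = trunc n x + coord x n *\<^sub>C ket n" by (simp add: trunc_eq_sum)
      ultimately show ?thesis using K(2)[OF that] by blast
    qed
    ultimately show ?case by blast
  qed
  then show ?thesis by (auto intro: compact_opI)
qed

lemma compact_op_tail:
  assumes "compact_op T"
  shows "(\<lambda>n. norm ((1 - coord_proj n) * T)) \<longlonglongrightarrow> 0"
proof (rule LIMSEQ_I)
  fix r :: real assume r: "0 < r"
  define e where "e = r / 3"
  have e: "0 < e" using r by (simp add: e_def)
  obtain F where F: "finite F" "\<And>x. norm x \<le> 1 \<Longrightarrow> \<exists>y\<in>F. norm (bop_apply T x - y) < e"
    using compact_op_net[OF assms e] by blast
  have "\<forall>\<^sub>F n in sequentially. \<forall>y\<in>F. norm (trunc n y - y) < e"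
    using F(1) tendstoD[OF trunc_tendsto e] by (intro eventually_ball_finite) (auto simp: dist_norm)
  then obtain N where N: "\<And>n y. n \<ge> N \<Longrightarrow> y \<in> F \<Longrightarrow> norm (trunc n y - y) < e"
    by (auto simp: eventually_sequentially)
  have "norm ((1 - coord_proj n) * T) \<le> 2 * e" if n: "n \<ge> N" for n
  proof (rule norm_le_ball)
    fix x :: ell2 assume "norm x \<le> 1"
    then obtain y where y: "y \<in> F" "norm (bop_apply T x - y) < e" using F(2) by blast
    have "bop_apply ((1 - coord_proj n) * T) x = bop_apply (1 - coord_proj n) (bop_apply T x - y) - (trunc n y - y)"
      by (simp add: bop_apply_diff[of "coord_proj n", simplified])
    also have "norm \<dots> \<le> norm (bop_apply (1 - coord_proj n) (bop_apply T x - y)) + norm (trunc n y - y)"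
      by (rule norm_triangle_ineq4)
    also have "\<dots> \<le> norm (bop_apply T x - y) + norm (trunc n y - y)"
      by (simp add: norm_tail_le)
    also have "\<dots> \<le> 2 * e" using y N[OF n y(1)] by simp
    finally show "norm (bop_apply ((1 - coord_proj n) * T) x) \<le> 2 * e" .
  qed (use e in simp)
  then have "norm (norm ((1 - coord_proj n) * T) - 0) < r" if "n \<ge> N" for n
    using that r e_def by fastforce
  then show "\<exists>no. \<forall>n\<ge>no. norm (norm ((1 - coord_proj n) * T) - 0) < r" by blast
qed

lemma compact_op_star:
  assumes "compact_op T" shows "compact_op (star T)"
proof -
  have "(\<lambda>n. norm (star T * coord_proj n - star T)) \<longlonglongrightarrow> 0"
  proof -
    have "norm (star T * coord_proj n - star T) = norm ((1 - coord_proj n) * T)" for n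
    proof -
      have "star ((1 - coord_proj n) * T) = - (star T * coord_proj n - star T)"
        by (simp add: star_mult star_diff star_coord_proj algebra_simps)
      then show ?thesis by (metis norm_minus_cancel norm_star)
    qed
    then show ?thesis using compact_op_tail[OF assms] by simp
  qed
  then have "(\<lambda>n. star T * coord_proj n) \<longlonglongrightarrow> star T"
    by (subst LIM_zero_iff[symmetric]) (rule tendsto_norm_zero_cancel)
  moreover have "star T * coord_proj n \<in> Collect compact_op" for n
    by (simp add: compact_op_mult_left compact_coord_proj)
  ultimately show ?thesis
    using closed_sequentially[OF compact_op_closed, of "\<lambda>n. star T * coord_proj n"] by simp
qed

lemma not_compact_op_one: "\<not> compact_op 1"
proof
  assume "compact_op 1"
  then have "(\<lambda>n. norm (1 - coord_proj n)) \<longlonglongrightarrow> 0" using compact_op_tail by fastforce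
  moreover have "1 \<le> norm (1 - coord_proj n)" for n
  proof -
    have "trunc n (ket n) = 0" by (rule ell2_eqI) (simp add: trunc.rep_eq ket.rep_eq)
    then show ?thesis using norm_bop_apply[of "1 - coord_proj n" "ket n"] by simp
  qed
  ultimately have "(1 :: real) \<le> 0" by (meson LIMSEQ_le_const)
  then show False by simp
qed

abbreviation qnorm :: "bop \<Rightarrow> real"
  where "qnorm T \<equiv> infdist T (Collect compact_op)"

lemma qnorm_le: "compact_op K \<Longrightarrow> qnorm T \<le> norm (T - K)"
  using infdist_le[of K "Collect compact_op" T] by (simp add: dist_norm)

lemma qnorm_bop_applyrox:
  assumes "0 < e" shows "\<exists>K. compact_op K \<and> norm (T - K) < qnorm T + e"
proof -
  have ne: "Collect compact_op \<noteq> {}" using compact_op_zero by blast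
  have "(INF K\<in>Collect compact_op. dist T K) < qnorm T + e"
    using assms by (simp add: infdist_notempty[OF ne, symmetric])
  then obtain K where "K \<in> Collect compact_op" "dist T K < qnorm T + e"
    using cInf_lessD[of "dist T ` Collect compact_op" "qnorm T + e"] ne by auto
  then show ?thesis by (auto simp: dist_norm)
qed

lemma qnorm_seq: "\<exists>K. (\<forall>n :: nat. compact_op (K n)) \<and> (\<lambda>n. norm (T - K n)) \<longlonglongrightarrow> qnorm T"
proof -
  have "\<forall>n :: nat. \<exists>K. compact_op K \<and> norm (T - K) < qnorm T + inverse (real (Suc n))"
    by (intro allI qnorm_bop_applyrox) simp
  then obtain K where K: "\<And>n. compact_op (K n)" "\<And>n. norm (T - K n) < qnorm T + inverse (real (Suc n))"
    by metis
  have "(\<lambda>n. norm (T - K n)) \<longlonglongrightarrow> qnorm T"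
  proof (rule tendsto_sandwich)
    show "\<forall>\<^sub>F n in sequentially. qnorm T \<le> norm (T - K n)" using qnorm_le K(1) by simp
    show "\<forall>\<^sub>F n in sequentially. norm (T - K n) \<le> qnorm T + inverse (real (Suc n))"
      using K(2) by (simp add: less_imp_le)
    show "(\<lambda>n. qnorm T + inverse (real (Suc n))) \<longlonglongrightarrow> qnorm T"
      using tendsto_add[OF tendsto_const LIMSEQ_inverse_real_of_nat] by fastforce
  qed simp
  with K(1) show ?thesis by blast
qed

lemma qnorm_add: "qnorm (S + T) \<le> qnorm S + qnorm T"
proof -
  obtain K where K: "\<And>n :: nat. compact_op (K n)" "(\<lambda>n. norm (S - K n)) \<longlonglongrightarrow> qnorm S" using qnorm_seq by metis
  obtain L where L: "\<And>n :: nat. compact_op (L n)" "(\<lambda>n. norm (T - L n)) \<longlonglongrightarrow> qnorm T" using qnorm_seq by metis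
  have "qnorm (S + T) \<le> norm (S - K n) + norm (T - L n)" for n
    using qnorm_le[OF compact_op_add[OF K(1) L(1)], of "S + T" n n]
      norm_triangle_ineq[of "S - K n" "T - L n"] by (simp add: algebra_simps)
  then show ?thesis by (intro LIMSEQ_le_const[OF tendsto_add[OF K(2) L(2)]]) blast
qed

lemma qnorm_mult: "qnorm (S * T) \<le> qnorm S * qnorm T"
proof -
  obtain K where K: "\<And>n :: nat. compact_op (K n)" "(\<lambda>n. norm (S - K n)) \<longlonglongrightarrow> qnorm S" using qnorm_seq by metis
  obtain L where L: "\<And>n :: nat. compact_op (L n)" "(\<lambda>n. norm (T - L n)) \<longlonglongrightarrow> qnorm T" using qnorm_seq by metis
  have "qnorm (S * T) \<le> norm (S - K n) * norm (T - L n)" for n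
  proof -
    have "compact_op (K n * T + (S - K n) * L n)"
      by (intro compact_op_add compact_op_mult_left compact_op_mult_right K L)
    then have "qnorm (S * T) \<le> norm (S * T - (K n * T + (S - K n) * L n))" by (rule qnorm_le)
    also have "S * T - (K n * T + (S - K n) * L n) = (S - K n) * (T - L n)" by (simp add: algebra_simps)
    also have "norm \<dots> \<le> norm (S - K n) * norm (T - L n)" by (rule norm_mult_ineq)
    finally show ?thesis .
  qed
  then show ?thesis by (intro LIMSEQ_le_const[OF tendsto_mult[OF K(2) L(2)]]) blast
qed

lemma qnorm_compact: "compact_op T \<Longrightarrow> qnorm T = 0"
  by (simp add: infdist_zero)

lemma qnorm_eq_0: "qnorm T = 0 \<longleftrightarrow> compact_op T"
  using in_closed_iff_infdist_zero[OF compact_op_closed, of T] compact_op_zero by blast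

lemma qnorm_cong: "compact_op (S - T) \<Longrightarrow> qnorm S = qnorm T"
proof (rule antisym)
  assume c: "compact_op (S - T)"
  show "qnorm S \<le> qnorm T" using qnorm_add[of "S - T" T] qnorm_compact[OF c] by simp
  have "compact_op (T - S)" using compact_op_minus[OF c] by simp
  then show "qnorm T \<le> qnorm S" using qnorm_add[of "T - S" S] qnorm_compact by simp
qed

lemma qnorm_scaleC_le: "qnorm (c *\<^sub>C T) \<le> cmod c * qnorm T"
proof -
  obtain K where K: "\<And>n :: nat. compact_op (K n)" "(\<lambda>n. norm (T - K n)) \<longlonglongrightarrow> qnorm T" using qnorm_seq by metis
  have "qnorm (c *\<^sub>C T) \<le> cmod c * norm (T - K n)" for n
  proof -
    have "c *\<^sub>C T - c *\<^sub>C K n = c *\<^sub>C (T - K n)"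
      using scaleC_add_right[of c "T - K n" "K n"] by simp
    then show ?thesis
      using qnorm_le[OF compact_op_scaleC[OF K(1)], of "c *\<^sub>C T" c n] by (simp add: norm_scaleC)
  qed
  then show ?thesis by (intro LIMSEQ_le_const[OF tendsto_mult[OF tendsto_const K(2)]]) blast
qed

lemma qnorm_scaleC: "qnorm (c *\<^sub>C T) = cmod c * qnorm T"
proof (cases "c = 0")
  case True
  then show ?thesis
    using qnorm_scaleC_le[of c T] infdist_nonneg[of "c *\<^sub>C T" "Collect compact_op"] by simp
next
  case False
  have "qnorm ((1 / c) *\<^sub>C c *\<^sub>C T) \<le> cmod (1 / c) * qnorm (c *\<^sub>C T)" by (rule qnorm_scaleC_le)
  then have "cmod c * qnorm T \<le> qnorm (c *\<^sub>C T)"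
    using False by (simp add: scaleC_scaleC norm_divide field_simps)
  with qnorm_scaleC_le show ?thesis by (rule antisym)
qed

lemma qnorm_one: "qnorm 1 = 1"
proof (rule antisym)
  show "qnorm 1 \<le> 1" using qnorm_le[OF compact_op_zero, of 1] by simp
  have "qnorm 1 > 0" 
    using qnorm_eq_0[of 1] not_compact_op_one infdist_nonneg[of 1 "Collect compact_op"] by linarith
  then show "1 \<le> qnorm 1" using qnorm_mult[of 1 1] by (simp add: mult_le_cancel_left1)
qed

lemma qnorm_star_le: "qnorm (star T) \<le> qnorm T"
proof -
  obtain K where K: "\<And>n :: nat. compact_op (K n)" "(\<lambda>n. norm (T - K n)) \<longlonglongrightarrow> qnorm T" using qnorm_seq by metis
  have "qnorm (star T) \<le> norm (T - K n)" for n
    using qnorm_le[OF compact_op_star[OF K(1)], of "star T" n]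
    by (simp add: star_diff[symmetric])
  then show ?thesis by (intro LIMSEQ_le_const[OF K(2)]) blast
qed

lemma qnorm_cstar: "qnorm (star T * T) = (qnorm T)\<^sup>2"
proof (rule antisym)
  have "qnorm (star T * T) \<le> qnorm (star T) * qnorm T" by (rule qnorm_mult)
  also have "\<dots> \<le> qnorm T * qnorm T" by (intro mult_right_mono qnorm_star_le infdist_nonneg)
  finally show "qnorm (star T * T) \<le> (qnorm T)\<^sup>2" by (simp add: power2_eq_square)
next
  have main: "(qnorm T)\<^sup>2 \<le> norm (star T * T - K)" if K: "compact_op K" for K
  proof -
    have "(qnorm T)\<^sup>2 \<le> norm (star T * T - K) + norm ((1 - coord_proj n) * K)" for n
    proof -
      define Q where "Q = 1 - coord_proj n"
      have Q: "star Q = Q" "norm Q \<le> 1"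
        by (simp_all add: Q_def star_diff star_coord_proj norm_compl_proj)
      have "qnorm T \<le> norm (T - T * coord_proj n)"
        by (intro qnorm_le compact_op_mult_left compact_coord_proj)
      also have "T - T * coord_proj n = T * Q" by (simp add: Q_def algebra_simps)
      finally have "(qnorm T)\<^sup>2 \<le> (norm (T * Q))\<^sup>2" by (intro power_mono infdist_nonneg)
      also have "\<dots> = norm (star (T * Q) * (T * Q))" by (rule cstar_identity[symmetric])
      also have "star (T * Q) * (T * Q) = Q * (star T * T - K) * Q + Q * K * Q"
        by (simp add: star_mult Q algebra_simps)
      also have "norm \<dots> \<le> norm (Q * (star T * T - K) * Q) + norm (Q * K * Q)" by (rule norm_triangle_ineq)
      also have "\<dots> \<le> norm (star T * T - K) + norm (Q * K)"
      proof (rule add_mono)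
        have right: "norm (X * Q) \<le> norm X" for X :: bop
          using norm_mult_ineq[of X Q] mult_left_mono[OF Q(2), of "norm X"] by simp
        have left: "norm (Q * X) \<le> norm X" for X :: bop
          using norm_mult_ineq[of Q X] mult_right_mono[OF Q(2), of "norm X"] by simp
        show "norm (Q * (star T * T - K) * Q) \<le> norm (star T * T - K)"
          using right left by (rule order_trans)
        show "norm (Q * K * Q) \<le> norm (Q * K)" by (rule right)
      qed
      finally show ?thesis by (simp add: Q_def)
    qed
    moreover have "(\<lambda>n. norm (star T * T - K) + norm ((1 - coord_proj n) * K)) \<longlonglongrightarrow> norm (star T * T - K) + 0"
      by (intro tendsto_add tendsto_const compact_op_tail K)
    ultimately show ?thesis using LIMSEQ_le_const by fastforce
  qed
  obtain K where K: "\<And>n :: nat. compact_op (K n)" "(\<lambda>n. norm (star T * T - K n)) \<longlonglongrightarrow> qnorm (star T * T)"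
    using qnorm_seq by metis
  show "(qnorm T)\<^sup>2 \<le> qnorm (star T * T)"
    using main K(1) by (intro LIMSEQ_le_const[OF K(2)]) blast
qed

lemma equivp_calkin: "equivp (\<lambda>S T. compact_op (S - T))"
proof (rule equivpI)
  show "symp (\<lambda>S T. compact_op (S - T))"
    by (rule sympI) (metis compact_op_minus minus_diff_eq)
  show "transp (\<lambda>S T. compact_op (S - T))"
    by (rule transpI) (metis compact_op_add diff_add_cancel add_diff_eq)
qed (auto intro: reflpI)

quotient_type calkin = bop / "\<lambda>S T. compact_op (S - T)"
  by (rule equivp_calkin)

lift_definition calkin_proj :: "bop \<Rightarrow> calkin" is "\<lambda>T. T" .

lemma calkin_proj_eq_iff: "calkin_proj S = calkin_proj T \<longleftrightarrow> compact_op (S - T)"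
  by transfer simp

lemma calkin_proj_surj: "\<exists>T. x = calkin_proj T"
  by transfer (metis compact_op_zero diff_self)

instantiation calkin :: complex_vector
begin

lift_definition zero_calkin :: calkin is 0 .
lift_definition plus_calkin :: "calkin \<Rightarrow> calkin \<Rightarrow> calkin" is "(+)"
  by (metis compact_op_add add_diff_add)
lift_definition uminus_calkin :: "calkin \<Rightarrow> calkin" is uminus
  by (metis compact_op_minus minus_diff_minus)
lift_definition minus_calkin :: "calkin \<Rightarrow> calkin \<Rightarrow> calkin" is "(-)"
  by (metis compact_op_diff diff_diff_eq2 diff_diff_add add_diff_add add.commute diff_add_eq)
lift_definition scaleR_calkin :: "real \<Rightarrow> calkin \<Rightarrow> calkin" is "(*\<^sub>R)"
  by (metis compact_op_scaleC scaleR_scaleC scaleR_diff_right)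
lift_definition scaleC_calkin :: "complex \<Rightarrow> calkin \<Rightarrow> calkin" is "(*\<^sub>C)"
proof -
  fix c :: complex and S T :: bop
  assume "compact_op (S - T)"
  then have "compact_op (c *\<^sub>C (S - T))" by (rule compact_op_scaleC)
  also have "c *\<^sub>C (S - T) = c *\<^sub>C S - c *\<^sub>C T" using scaleC_add_right[of c "S - T" T] by simp
  finally show "compact_op (c *\<^sub>C S - c *\<^sub>C T)" .
qed

instance
  by (intro_classes; transfer)
     (simp_all add: algebra_simps scaleC_add_right scaleC_add_left scaleC_scaleC scaleR_scaleC)

end

instantiation calkin :: "{complex_normed_vector, real_normed_algebra_1}"
begin

lift_definition one_calkin :: calkin is 1 .
lift_definition times_calkin :: "calkin \<Rightarrow> calkin \<Rightarrow> calkin" is "(*)"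
proof -
  fix S S' T T' :: bop
  assume "compact_op (S - S')" "compact_op (T - T')"
  then have "compact_op ((S - S') * T + S' * (T - T'))"
    by (intro compact_op_add compact_op_mult_left compact_op_mult_right)
  then show "compact_op (S * T - S' * T')" by (simp add: algebra_simps)
qed
lift_definition norm_calkin :: "calkin \<Rightarrow> real" is "\<lambda>T. infdist T (Collect compact_op)"
  by (rule qnorm_cong)

definition sgn_calkin :: "calkin \<Rightarrow> calkin"
  where "sgn_calkin x = x /\<^sub>R norm x"
definition dist_calkin :: "calkin \<Rightarrow> calkin \<Rightarrow> real"
  where "dist_calkin x y = norm (x - y)"
definition uniformity_calkin :: "(calkin \<times> calkin) filter"
  where "uniformity_calkin = (INF e\<in>{0 <..}. principal {(x, y). dist x y < e})"
definition open_calkin :: "calkin set \<Rightarrow> bool"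
  where "open_calkin U \<longleftrightarrow> (\<forall>x\<in>U. eventually (\<lambda>(x', y). x' = x \<longrightarrow> y \<in> U) uniformity)"

lemma calkin_proj_simps_calkin:
  "calkin_proj (S + T) = calkin_proj S + calkin_proj T"
  "calkin_proj (S - T) = calkin_proj S - calkin_proj T"
  "calkin_proj (- S) = - calkin_proj S"
  "calkin_proj 0 = 0"
  "calkin_proj (r *\<^sub>R S) = r *\<^sub>R calkin_proj S"
  "calkin_proj (c *\<^sub>C S) = c *\<^sub>C calkin_proj S"
  "calkin_proj (S * T) = calkin_proj S * calkin_proj T"
  "calkin_proj 1 = 1"
  by (transfer; simp)+

lemma norm_calkin_proj_calkin: "norm (calkin_proj T) = qnorm T"
  by transfer simp

lemma calkin_proj_lift_calkin:
  assumes "norm x < b" shows "\<exists>T. calkin_proj T = x \<and> norm T < b"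
proof -
  obtain S where S: "x = calkin_proj S" using calkin_proj_surj by blast
  obtain K where K: "compact_op K" "norm (S - K) < qnorm S + (b - norm x)"
    using qnorm_bop_applyrox[of "b - norm x" S] assms by auto
  have "calkin_proj (S - K) = x"
    using compact_op_minus[OF K(1)] by (simp add: S calkin_proj_eq_iff)
  moreover have "norm (S - K) < b" using K(2) by (simp add: S norm_calkin_proj_calkin)
  ultimately show ?thesis by blast
qed

instance
proof
  fix x y z :: calkin and r :: real and c :: complex
  obtain S where S: "x = calkin_proj S" using calkin_proj_surj by blast
  obtain T where T: "y = calkin_proj T" using calkin_proj_surj by blast
  obtain U where U: "z = calkin_proj U" using calkin_proj_surj by blast
  note [simp] = S T U and s = calkin_proj_simps_calkin[symmetric]
  show "x * y * z = x * (y * z)" "(x + y) * z = x * z + y * z" "x * (y + z) = x * y + x * z"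
    "1 * x = x" "x * 1 = x" "r *\<^sub>R x * y = r *\<^sub>R (x * y)" "x * r *\<^sub>R y = r *\<^sub>R (x * y)"
    by (simp_all add: s algebra_simps)
  show "(0 :: calkin) \<noteq> 1"
    using not_compact_op_one compact_op_minus[of "- 1"] by (auto simp: s calkin_proj_eq_iff)
  show "norm x = 0 \<longleftrightarrow> x = 0"
    unfolding S norm_calkin_proj_calkin qnorm_eq_0 calkin_proj_simps_calkin(4)[symmetric] calkin_proj_eq_iff
    by simp
  show "norm (x + y) \<le> norm x + norm y"
    by (simp add: s norm_calkin_proj_calkin qnorm_add)
  show "norm (r *\<^sub>R x) = \<bar>r\<bar> * norm x"
    by (simp add: s norm_calkin_proj_calkin scaleR_scaleC qnorm_scaleC)
  show "norm (c *\<^sub>C x) = cmod c * norm x"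
    by (simp add: s norm_calkin_proj_calkin qnorm_scaleC)
  show "norm (x * y) \<le> norm x * norm y"
    by (simp add: s norm_calkin_proj_calkin qnorm_mult)
  show "norm (1 :: calkin) = 1"
    by (simp add: s norm_calkin_proj_calkin qnorm_one)
qed (rule sgn_calkin_def dist_calkin_def uniformity_calkin_def open_calkin_def)+

end

instance calkin :: banach
proof
  fix X :: "nat \<Rightarrow> calkin"
  assume X: "Cauchy X"
  have "\<forall>n :: nat. \<exists>M. \<forall>m\<ge>M. \<forall>m'\<ge>M. norm (X m - X m') < (1 / 2) ^ n"
    by (intro allI CauchyD[OF X]) simp
  then obtain M where M: "\<And>n m m'. m \<ge> M n \<Longrightarrow> m' \<ge> M n \<Longrightarrow> norm (X m - X m') < (1 / 2) ^ n"
    by metis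
  define r where "r n = (\<Sum>k\<le>n. M k) + n" for n
  have r_ge: "M n \<le> r n" for n
    by (simp add: r_def trans_le_add1 member_le_sum)
  have r_Suc: "r n < r (Suc n)" for n by (simp add: r_def)
  have "\<exists>D. calkin_proj D = X (r (Suc n)) - X (r n) \<and> norm D < (1 / 2) ^ n" for n
    using r_ge[of n] r_Suc[of n] by (intro calkin_proj_lift_calkin M) auto
  then obtain D where D: "\<And>n. calkin_proj (D n) = X (r (Suc n)) - X (r n)" "\<And>n. norm (D n) < (1 / 2) ^ n"
    by metis
  obtain T0 where T0: "X (r 0) = calkin_proj T0" using calkin_proj_surj by blast
  have "summable D"
    by (rule summable_comparison_test'[of "\<lambda>n. (1 / 2) ^ n"]) (use D(2) in \<open>auto intro: less_imp_le\<close>)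
  then have lim: "(\<lambda>n. T0 + (\<Sum>k<n. D k)) \<longlonglongrightarrow> T0 + suminf D"
    by (intro tendsto_add tendsto_const summable_LIMSEQ)
  have Xr: "calkin_proj (T0 + (\<Sum>k<n. D k)) = X (r n)" for n
    by (induction n) (simp_all add: calkin_proj_simps_calkin T0 D(1) add.assoc[symmetric])
  have norm_le: "norm (calkin_proj T) \<le> norm T" for T
    using qnorm_le[OF compact_op_zero, of T] by (simp add: norm_calkin_proj_calkin)
  define L where "L = calkin_proj (T0 + suminf D)"
  have "(\<lambda>n. norm ((T0 + (\<Sum>k<n. D k)) - (T0 + suminf D))) \<longlonglongrightarrow> 0"
    using lim LIM_zero tendsto_norm_zero by blast
  then have "(\<lambda>n. norm (X (r n) - L)) \<longlonglongrightarrow> 0"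
    by (rule Lim_null_comparison[rotated])
       (simp add: L_def Xr[symmetric] calkin_proj_simps_calkin(2)[symmetric] norm_le del: add_diff_cancel_left)
  then have "(X \<circ> r) \<longlonglongrightarrow> L"
    by (subst LIM_zero_iff[symmetric]) (simp add: tendsto_norm_zero_iff comp_def)
  moreover have "strict_mono r" by (simp add: strict_mono_Suc_iff r_Suc)
  ultimately have "X \<longlonglongrightarrow> L" using Cauchy_converges_subseq[OF X] by blast
  then show "convergent X" by (auto simp: convergent_def)
qed

instantiation calkin :: cstar_algebra
begin

lift_definition star_calkin :: "calkin \<Rightarrow> calkin" is star
  by (metis compact_op_star star_diff)

lemma calkin_proj_star_calkin: "calkin_proj (star S) = star (calkin_proj S)"
  by transfer simp

instance
proof
  fix x y z :: calkin and r :: real and c :: complex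
  obtain S where S: "x = calkin_proj S" using calkin_proj_surj by blast
  obtain T where T: "y = calkin_proj T" using calkin_proj_surj by blast
  note [simp] = S T and s = calkin_proj_simps_calkin[symmetric] calkin_proj_star_calkin[symmetric]
  show "c *\<^sub>C x * y = c *\<^sub>C (x * y)" "x * c *\<^sub>C y = c *\<^sub>C (x * y)"
    "star (star x) = x" "star (x + y) = star x + star y" "star (c *\<^sub>C x) = cnj c *\<^sub>C star x"
    "star (x * y) = star y * star x"
    by (simp_all add: s mult_scaleC_left mult_scaleC_right star_add star_scaleC star_mult)
  show "norm (star x * x) = (norm x)\<^sup>2"
    by (simp add: s norm_calkin_proj_calkin qnorm_cstar)
qed

end

lemmas calkin_proj_simps = calkin_proj_simps_calkin calkin_proj_star_calkin
lemmas norm_calkin_proj = norm_calkin_proj_calkin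

lifting_forget calkin.lifting

definition operator_system :: "'a :: cstar_algebra set \<Rightarrow> bool"
  where "operator_system S \<longleftrightarrow>
    1 \<in> S \<and> (\<forall>x\<in>S. \<forall>y\<in>S. x + y \<in> S) \<and> (\<forall>c. \<forall>x\<in>S. c *\<^sub>C x \<in> S) \<and> (\<forall>x\<in>S. star x \<in> S)"

definition cstar_subalgebra :: "'a :: cstar_algebra set \<Rightarrow> bool"
  where "cstar_subalgebra A \<longleftrightarrow>
    closed A \<and> 0 \<in> A \<and> (\<forall>x\<in>A. \<forall>y\<in>A. x + y \<in> A) \<and> (\<forall>c. \<forall>x\<in>A. c *\<^sub>C x \<in> A) \<and>
    (\<forall>x\<in>A. \<forall>y\<in>A. x * y \<in> A) \<and> (\<forall>x\<in>A. star x \<in> A)"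

definition cstar_generated :: "'a :: cstar_algebra set \<Rightarrow> 'a set"
  where "cstar_generated S = cstar_subalgebra hull S"

lemma cstar_subalgebra_generated: "cstar_subalgebra (cstar_generated S)"
  unfolding cstar_generated_def by (rule hull_in) (auto simp: cstar_subalgebra_def)

lemma cstar_generated_superset: "S \<subseteq> cstar_generated S"
  unfolding cstar_generated_def by (rule hull_subset)

text \<open>An \<^term>\<open>n\<close> by \<^term>\<open>n\<close> matrix over a C*-algebra is a function of two indices, of which only the
  values below \<^term>\<open>n\<close> count.  It is positive in the C*-algebra $M_n$ iff it is $y^* y$ for some matrix $y$
  over the ambient algebra.\<close>

definition positive_matrix :: "nat \<Rightarrow> (nat \<Rightarrow> nat \<Rightarrow> 'a :: cstar_algebra) \<Rightarrow> bool"
  where "positive_matrix n x \<longleftrightarrow>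
    (\<exists>y. \<forall>i<n. \<forall>j<n. x i j = (\<Sum>k<n. star (y k i) * y k j))"

text \<open>Maps defined on a subset of a C*-algebra are represented by total functions whose values outside
  the subset play no role.\<close>

definition ucp_on :: "'a :: cstar_algebra set \<Rightarrow> ('a \<Rightarrow> 'b :: cstar_algebra) \<Rightarrow> bool"
  where "ucp_on S \<phi> \<longleftrightarrow>
    \<phi> 1 = 1 \<and>
    (\<forall>x\<in>S. \<forall>y\<in>S. \<phi> (x + y) = \<phi> x + \<phi> y) \<and> (\<forall>c. \<forall>x\<in>S. \<phi> (c *\<^sub>C x) = c *\<^sub>C \<phi> x) \<and>
    (\<forall>n x. (\<forall>i<n. \<forall>j<n. x i j \<in> S) \<longrightarrow> positive_matrix n x \<longrightarrow> positive_matrix n (\<lambda>i j. \<phi> (x i j)))"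

definition smith_ward :: "bop set \<Rightarrow> bool"
  where "smith_ward R \<longleftrightarrow>
    (\<exists>\<psi> :: calkin \<Rightarrow> bop. ucp_on (calkin_proj ` R) \<psi> \<and> (\<forall>y\<in>calkin_proj ` R. calkin_proj (\<psi> y) = y))"

definition unital_star_hom_on :: "'a :: cstar_algebra set \<Rightarrow> ('a \<Rightarrow> 'b :: cstar_algebra) \<Rightarrow> bool"
  where "unital_star_hom_on A f \<longleftrightarrow>
    f 1 = 1 \<and>
    (\<forall>x\<in>A. \<forall>y\<in>A. f (x + y) = f x + f y) \<and> (\<forall>c. \<forall>x\<in>A. f (c *\<^sub>C x) = c *\<^sub>C f x) \<and>
    (\<forall>x\<in>A. \<forall>y\<in>A. f (x * y) = f x * f y) \<and> (\<forall>x\<in>A. f (star x) = star (f x))"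

definition unitary :: "'a :: cstar_algebra \<Rightarrow> bool"
  where "unitary u \<longleftrightarrow> star u * u = 1 \<and> u * star u = 1"

definition extension :: "'a :: cstar_algebra set \<Rightarrow> ('a \<Rightarrow> calkin) \<Rightarrow> bool"
  where "extension A \<sigma> \<longleftrightarrow> unital_star_hom_on A \<sigma> \<and> inj_on \<sigma> A"

definition ext_rel :: "'a :: cstar_algebra set \<Rightarrow> (('a \<Rightarrow> calkin) \<times> ('a \<Rightarrow> calkin)) set"
  where "ext_rel A = {(\<sigma>, \<tau>). extension A \<sigma> \<and> extension A \<tau> \<and>
    (\<exists>u. unitary u \<and> (\<forall>a\<in>A. \<tau> a = calkin_proj u * \<sigma> a * star (calkin_proj u)))}"

definition Ext :: "'a :: cstar_algebra set \<Rightarrow> ('a \<Rightarrow> calkin) set set"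
  where "Ext A = Collect (extension A) // ext_rel A"

definition Ext_class :: "'a :: cstar_algebra set \<Rightarrow> ('a \<Rightarrow> calkin) \<Rightarrow> ('a \<Rightarrow> calkin) set"
  where "Ext_class A \<sigma> = ext_rel A `` {\<sigma>}"

text \<open>For \<^term>\<open>i \<in> {0, 1 :: nat}\<close>, the isometry taking the $n$-th basis vector to the $(2n + i)$-th.
  Their ranges are orthogonal with sum $\ell^2(\mathbb N)$, so $(x, y) \mapsto V_0 x + V_1 y$ is a
  unitary identification of $\ell^2(\mathbb N) \oplus \ell^2(\mathbb N)$ with $\ell^2(\mathbb N)$, and it
  carries $S \oplus T$ to $V_0 S V_0^* + V_1 T V_1^*$.\<close>

definition summand_isom :: "nat \<Rightarrow> bop"
  where "summand_isom i =
    (THE V. \<forall>x n. coord (bop_apply V x) n = (if n mod 2 = i then coord x (n div 2) else 0))"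

lemma coord_summand_isom:
  "coord (bop_apply (summand_isom i) x) n = (if n mod 2 = i then coord x (n div 2) else 0)"
proof -
  have "\<exists>y. coord y = (\<lambda>n. if n mod 2 = i then coord x (n div 2) else 0) \<and> norm y \<le> norm x" for x
  proof (rule ell2_of_bounded_sums)
    fix N
    define J where "J = {n. n < N \<and> n mod 2 = i}"
    have "(\<Sum>n<N. (cmod (if n mod 2 = i then coord x (n div 2) else 0))\<^sup>2)
        = (\<Sum>n\<in>J. (cmod (coord x (n div 2)))\<^sup>2)"
      by (rule sum.mono_neutral_cong_right) (auto simp: J_def)
    also have "\<dots> = (\<Sum>k\<in>(\<lambda>n. n div 2) ` J. (cmod (coord x k))\<^sup>2)"
    proof (rule sum.reindex_cong[symmetric])
      show "inj_on (\<lambda>n. n div 2) J"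
        by (rule inj_onI) (simp add: J_def, metis div_mult_mod_eq)
    qed simp_all
    also have "\<dots> \<le> (\<Sum>k<N. (cmod (coord x k))\<^sup>2)"
      by (rule sum_mono2) (auto simp: J_def)
    also have "\<dots> \<le> (norm x)\<^sup>2" by (rule sum_coord_le)
    finally show "(\<Sum>n<N. (cmod (if n mod 2 = i then coord x (n div 2) else 0))\<^sup>2) \<le> (norm x)\<^sup>2" .
  qed simp
  then obtain f where f: "\<And>x. coord (f x) = (\<lambda>n. if n mod 2 = i then coord x (n div 2) else 0)"
    "\<And>x. norm (f x) \<le> norm x" by metis
  have "\<exists>V. bop_apply V = f"
    by (rule bop_exists[of _ 1]) (auto intro!: ell2_eqI simp: f)
  then obtain V where V: "bop_apply V = f" ..
  have "\<forall>x n. coord (bop_apply (summand_isom i) x) n = (if n mod 2 = i then coord x (n div 2) else 0)"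
    unfolding summand_isom_def
  proof (rule theI[where a = V])
    show "\<forall>x n. coord (bop_apply V x) n = (if n mod 2 = i then coord x (n div 2) else 0)" by (simp add: V f)
    fix W assume "\<forall>x n. coord (bop_apply W x) n = (if n mod 2 = i then coord x (n div 2) else 0)"
    then show "W = V" by (intro bop_eqI ell2_eqI) (simp add: V f)
  qed
  then show ?thesis by blast
qed

lemma coord_star_summand_isom:
  assumes "i < 2" shows "coord (bop_apply (star (summand_isom i)) x) n = coord x (2 * n + i)"
proof -
  have "bop_apply (summand_isom i) (ket n) = ket (2 * n + i)"
    using assms by (intro ell2_eqI) (auto simp: coord_summand_isom ket.rep_eq)
  then have "cinner (ket n) (bop_apply (star (summand_isom i)) x) = cinner (ket (2 * n + i)) x"
    using cinner_star[of "star (summand_isom i)" "ket n" x] by simp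
  then show ?thesis by (simp add: cinner_ket)
qed

lemma summand_isom_relations:
  "star (summand_isom 0) * summand_isom 0 = 1" "star (summand_isom 1) * summand_isom 1 = 1"
  "star (summand_isom 0) * summand_isom 1 = 0" "star (summand_isom 1) * summand_isom 0 = 0"
  "summand_isom 0 * star (summand_isom 0) + summand_isom 1 * star (summand_isom 1) = 1"
proof -
  show "summand_isom 0 * star (summand_isom 0) + summand_isom 1 * star (summand_isom 1) = 1"
  proof (intro bop_eqI ell2_eqI)
    fix x and n :: nat
    obtain k where "n = 2 * k \<or> n = 2 * k + 1" by (metis evenE oddE)
    then show "coord (bop_apply (summand_isom 0 * star (summand_isom 0) + summand_isom 1 * star (summand_isom 1)) x) n
        = coord (bop_apply 1 x) n"
      by (auto simp: coord_summand_isom coord_star_summand_isom)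
  qed
qed (intro bop_eqI ell2_eqI; simp add: coord_summand_isom coord_star_summand_isom)+

definition bop_dsum :: "bop \<Rightarrow> bop \<Rightarrow> bop"
  where "bop_dsum S T =
    summand_isom 0 * S * star (summand_isom 0) + summand_isom 1 * T * star (summand_isom 1)"

definition calkin_dsum :: "calkin \<Rightarrow> calkin \<Rightarrow> calkin"
  where "calkin_dsum x y =
    calkin_proj (summand_isom 0) * x * star (calkin_proj (summand_isom 0)) +
    calkin_proj (summand_isom 1) * y * star (calkin_proj (summand_isom 1))"

lemma calkin_dsum_proj: "calkin_dsum (calkin_proj S) (calkin_proj T) = calkin_proj (bop_dsum S T)"
  by (simp add: calkin_dsum_def bop_dsum_def calkin_proj_simps)

definition ext_dsum :: "('a \<Rightarrow> calkin) \<Rightarrow> ('a \<Rightarrow> calkin) \<Rightarrow> 'a \<Rightarrow> calkin"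
  where "ext_dsum \<sigma> \<tau> = (\<lambda>a. calkin_dsum (\<sigma> a) (\<tau> a))"

definition Ext_add ::
  "'a :: cstar_algebra set \<Rightarrow> ('a \<Rightarrow> calkin) set \<Rightarrow> ('a \<Rightarrow> calkin) set \<Rightarrow> ('a \<Rightarrow> calkin) set"
  where "Ext_add A c d = (\<Union>\<sigma>\<in>c. \<Union>\<tau>\<in>d. Ext_class A (ext_dsum \<sigma> \<tau>))"

text \<open>The neutral element.  For separable \<^term>\<open>A\<close> with unit this set is a single class, by Voiculescu's theorem.\<close>

definition Ext_zero :: "'a :: cstar_algebra set \<Rightarrow> ('a \<Rightarrow> calkin) set"
  where "Ext_zero A = {\<sigma>. extension A \<sigma> \<and>
    (\<exists>\<rho> :: 'a \<Rightarrow> bop. unital_star_hom_on A \<rho> \<and> (\<forall>a\<in>A. calkin_proj (\<rho> a) = \<sigma> a))}"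

definition Ext_invertible :: "'a :: cstar_algebra set \<Rightarrow> ('a \<Rightarrow> calkin) set \<Rightarrow> bool"
  where "Ext_invertible A c \<longleftrightarrow> c \<in> Ext A \<and> (\<exists>d\<in>Ext A. Ext_add A c d = Ext_zero A)"

lemma equiv_ext_rel: "equiv (Collect (extension A)) (ext_rel A)"
proof (rule equivI)
  show "ext_rel A \<subseteq> Collect (extension A) \<times> Collect (extension A)" by (auto simp: ext_rel_def)
  show "refl_on (Collect (extension A)) (ext_rel A)"
    by (rule refl_onI)
       (auto simp: ext_rel_def unitary_def calkin_proj_simps intro!: exI[of _ 1])
  show "sym (ext_rel A)"
  proof (rule symI)
    fix \<sigma> \<tau> assume "(\<sigma>, \<tau>) \<in> ext_rel A"
    then obtain u where u: "unitary u" "\<forall>a\<in>A. \<tau> a = calkin_proj u * \<sigma> a * star (calkin_proj u)"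
      and e: "extension A \<sigma>" "extension A \<tau>" by (auto simp: ext_rel_def)
    have "calkin_proj (star u * u) = calkin_proj 1" using u(1) by (simp add: unitary_def)
    then have *: "star (calkin_proj u) * calkin_proj u = 1" by (simp add: calkin_proj_simps)
    have "\<sigma> a = calkin_proj (star u) * \<tau> a * star (calkin_proj (star u))" if "a \<in> A" for a
    proof -
      have "calkin_proj (star u) * \<tau> a * star (calkin_proj (star u))
          = (star (calkin_proj u) * calkin_proj u) * \<sigma> a * (star (calkin_proj u) * calkin_proj u)"
        using u(2) that by (simp add: calkin_proj_simps mult.assoc)
      then show ?thesis by (simp add: *)
    qed
    moreover have "unitary (star u)" using u(1) by (simp add: unitary_def)
    ultimately show "(\<tau>, \<sigma>) \<in> ext_rel A" using e by (auto simp: ext_rel_def)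
  qed
  show "trans (ext_rel A)"
  proof (rule transI)
    fix \<rho> \<sigma> \<tau> assume "(\<rho>, \<sigma>) \<in> ext_rel A" "(\<sigma>, \<tau>) \<in> ext_rel A"
    then obtain u v where u: "unitary u" "\<forall>a\<in>A. \<sigma> a = calkin_proj u * \<rho> a * star (calkin_proj u)"
      and v: "unitary v" "\<forall>a\<in>A. \<tau> a = calkin_proj v * \<sigma> a * star (calkin_proj v)"
      and e: "extension A \<rho>" "extension A \<tau>" by (auto simp: ext_rel_def)
    have "unitary (v * u)"
    proof -
      have "star (v * u) * (v * u) = star u * (star v * v) * u"
        "(v * u) * star (v * u) = v * (u * star u) * star v"
        by (simp_all add: star_mult mult.assoc)
      then show ?thesis using u(1) v(1) by (simp add: unitary_def)
    qed
    moreover have "\<forall>a\<in>A. \<tau> a = calkin_proj (v * u) * \<rho> a * star (calkin_proj (v * u))"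
      using u(2) v(2) by (simp add: calkin_proj_simps star_mult mult.assoc)
    ultimately show "(\<rho>, \<tau>) \<in> ext_rel A" using e by (auto simp: ext_rel_def)
  qed
qed

lemma dsum_isom_calkin:
  fixes v w :: calkin
  assumes "v = calkin_proj (summand_isom 0)" "w = calkin_proj (summand_isom 1)"
  shows "star v * v = 1" "star w * w = 1" "star v * w = 0" "star w * v = 0" "v * star v + w * star w = 1"
  using summand_isom_relations[THEN arg_cong[of _ _ calkin_proj]]
  by (simp_all add: assms calkin_proj_simps)

lemma star_zero [simp]: "star 0 = (0 :: 'a :: cstar_algebra)"
  using star_diff[of 0 "0 :: 'a"] by simp

lemma calkin_dsum_simps:
  "calkin_dsum 1 1 = 1"
  "calkin_dsum (x + x') (y + y') = calkin_dsum x y + calkin_dsum x' y'"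
  "calkin_dsum (c *\<^sub>C x) (c *\<^sub>C y) = c *\<^sub>C calkin_dsum x y"
  "calkin_dsum (x * x') (y * y') = calkin_dsum x y * calkin_dsum x' y'"
  "calkin_dsum (star x) (star y) = star (calkin_dsum x y)"
proof -
  define v where "v = calkin_proj (summand_isom 0)"
  define w where "w = calkin_proj (summand_isom 1)"
  note rel = dsum_isom_calkin[OF v_def w_def]
  have rel': "star v * (v * z) = z" "star w * (w * z) = z" "star v * (w * z) = 0" "star w * (v * z) = 0" for z
    using rel by (simp_all add: mult.assoc[symmetric])
  have d: "calkin_dsum x y = v * x * star v + w * y * star w" for x y
    by (simp add: calkin_dsum_def v_def w_def)
  show "calkin_dsum 1 1 = 1" by (simp add: d rel)
  show "calkin_dsum (x + x') (y + y') = calkin_dsum x y + calkin_dsum x' y'"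
    by (simp add: d algebra_simps)
  show "calkin_dsum (c *\<^sub>C x) (c *\<^sub>C y) = c *\<^sub>C calkin_dsum x y"
    by (simp add: d mult_scaleC_left mult_scaleC_right scaleC_add_right)
  show "calkin_dsum (x * x') (y * y') = calkin_dsum x y * calkin_dsum x' y'"
    by (simp add: d distrib_left distrib_right mult.assoc rel')
  show "calkin_dsum (star x) (star y) = star (calkin_dsum x y)"
    by (simp add: d star_add star_mult mult.assoc)
qed

lemma calkin_dsum_inj: "calkin_dsum x y = calkin_dsum x' y' \<Longrightarrow> x = x' \<and> y = y'"
proof -
  assume eq: "calkin_dsum x y = calkin_dsum x' y'"
  define v where "v = calkin_proj (summand_isom 0)"
  define w where "w = calkin_proj (summand_isom 1)"
  note rel = dsum_isom_calkin[OF v_def w_def]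
  have rel': "star v * (v * z) = z" "star w * (w * z) = z" "star v * (w * z) = 0" "star w * (v * z) = 0" for z
    using rel by (simp_all add: mult.assoc[symmetric])
  have d: "calkin_dsum x y = v * x * star v + w * y * star w" for x y
    by (simp add: calkin_dsum_def v_def w_def)
  have "star v * calkin_dsum x y * v = x" "star w * calkin_dsum x y * w = y" for x y
    by (simp_all add: d distrib_left distrib_right mult.assoc rel rel')
  then show ?thesis using eq by metis
qed

lemma extension_inclusion: "extension A (\<lambda>a. a)"
  by (simp add: extension_def unital_star_hom_on_def)

lemma extension_dsum:
  assumes "extension A \<sigma>" "extension A \<tau>" shows "extension A (ext_dsum \<sigma> \<tau>)"
  using assms unfolding extension_def unital_star_hom_on_def ext_dsum_def
  by (auto simp: calkin_dsum_simps inj_on_def dest: calkin_dsum_inj)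

lemma unitary_bop_dsum:
  assumes "unitary u" "unitary v" shows "unitary (bop_dsum u v)"
proof -
  define p where "p = summand_isom 0"
  define q where "q = summand_isom 1"
  note rel = summand_isom_relations[folded p_def q_def]
  have rel': "star p * (p * z) = z" "star q * (q * z) = z" "star p * (q * z) = 0" "star q * (p * z) = 0" for z
    using rel by (simp_all add: mult.assoc[symmetric])
  have u: "star u * (u * z) = z" "u * (star u * z) = z" "star v * (v * z) = z" "v * (star v * z) = z" for z
    using assms by (simp_all add: unitary_def mult.assoc[symmetric])
  show ?thesis
    unfolding unitary_def bop_dsum_def p_def[symmetric] q_def[symmetric]
    by (simp add: star_add star_mult distrib_left distrib_right mult.assoc rel' u rel(5))
qed

lemma ext_rel_dsum:
  assumes "(\<sigma>, \<sigma>') \<in> ext_rel A" "(\<tau>, \<tau>') \<in> ext_rel A"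
  shows "(ext_dsum \<sigma> \<tau>, ext_dsum \<sigma>' \<tau>') \<in> ext_rel A"
proof -
  obtain u v where u: "unitary u" "\<forall>a\<in>A. \<sigma>' a = calkin_proj u * \<sigma> a * star (calkin_proj u)"
    and v: "unitary v" "\<forall>a\<in>A. \<tau>' a = calkin_proj v * \<tau> a * star (calkin_proj v)"
    and e: "extension A \<sigma>" "extension A \<sigma>'" "extension A \<tau>" "extension A \<tau>'"
    using assms by (auto simp: ext_rel_def)
  have "\<forall>a\<in>A. ext_dsum \<sigma>' \<tau>' a
      = calkin_proj (bop_dsum u v) * ext_dsum \<sigma> \<tau> a * star (calkin_proj (bop_dsum u v))"
    using u(2) v(2) by (simp add: ext_dsum_def calkin_dsum_simps flip: calkin_dsum_proj)
  then show ?thesis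
    using unitary_bop_dsum[OF u(1) v(1)] e by (auto simp: ext_rel_def intro: extension_dsum)
qed

lemma Ext_add_class:
  assumes "extension A \<sigma>" "extension A \<tau>"
  shows "Ext_add A (Ext_class A \<sigma>) (Ext_class A \<tau>) = Ext_class A (ext_dsum \<sigma> \<tau>)"
proof -
  have "Ext_class A (ext_dsum \<sigma>' \<tau>') = Ext_class A (ext_dsum \<sigma> \<tau>)"
    if "(\<sigma>, \<sigma>') \<in> ext_rel A" "(\<tau>, \<tau>') \<in> ext_rel A" for \<sigma>' \<tau>'
    using equiv_class_eq[OF equiv_ext_rel ext_rel_dsum[OF that]] by (simp add: Ext_class_def)
  moreover have "(\<sigma>, \<sigma>) \<in> ext_rel A" "(\<tau>, \<tau>) \<in> ext_rel A"
    using assms equiv_ext_rel[of A] by (auto simp: equiv_def refl_on_def)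
  ultimately show ?thesis unfolding Ext_add_def Ext_class_def[of A \<sigma>] Ext_class_def[of A \<tau>] by blast
qed

end

theory Submission
  imports Defs
begin

text \<open>If \<open>\<tau>\<close> represents an inverse of the class of the inclusion \<open>\<iota>\<close>, then \<open>\<iota> \<oplus> \<tau>\<close> lifts to a unital
  \<open>*\<close>-homomorphism \<open>\<rho>\<close>, and compressing \<open>\<rho>\<close> to the first summand gives a lift of \<open>\<iota>\<close>.  The compression
  is completely positive because a matrix over \<open>A\<close> that is positive over the Calkin algebra already has
  the form \<open>z\<^sup>* z\<close> with \<open>z\<close> over \<open>A\<close>: matrices embed into the Calkin algebra by means of isometries with
  orthogonal ranges, and there a positive element \<open>x\<close> can be scaled so that \<open>\<parallel>1 - x\<parallel> \<le> 1\<close> (lift to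
  operators), whence the binomial series of \<open>(1 - (1 - x))\<^bsup>1/2\<^esup>\<close> gives a square root inside any closed
  subalgebra containing \<open>1\<close> and \<open>x\<close>.\<close>

section \<open>Absolute convergence of the binomial series for exponent 1/2\<close>

text \<open>After the constant term, all terms \<open>(-1) ^ k * (1/2 gchoose k)\<close> are
  nonpositive. The sum of their absolute values is thus 1 minus an alternating partial sum, which
  has a nonnegative closed form. This gives convergence on the boundary of the unit ball, which the
  square root below requires.\<close>

lemma summable_abs_gbinomial_half: "summable (\<lambda>k. \<bar>(1/2 :: real) gchoose k\<bar>)"
proof -
  have sgn: "(-1) ^ m * ((-1/2 :: real) gchoose m) \<ge> 0" for m
  proof -
    have "(-1) ^ m * ((-1/2 :: real) gchoose m) = pochhammer (1/2) m / fact m"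
      by (simp add: gbinomial_pochhammer power_mult_distrib[symmetric] mult.assoc[symmetric])
    then show ?thesis by (simp add: pochhammer_nonneg)
  qed
  have abs_eq: "\<bar>(1/2 :: real) gchoose Suc k\<bar> = - ((-1) ^ Suc k * (1/2 gchoose Suc k))" for k
  proof -
    have "- ((-1) ^ Suc k * ((1/2 :: real) gchoose Suc k))
        = (1/2) / of_nat (Suc k) * ((-1) ^ k * ((-1/2) gchoose k))"
      by (simp add: gbinomial_absorption' field_simps)
    also have "\<dots> \<ge> 0" by (intro mult_nonneg_nonneg sgn) simp
    finally have "- ((-1) ^ Suc k * ((1/2 :: real) gchoose Suc k)) \<ge> 0" .
    moreover have "\<bar>- ((-1) ^ Suc k * ((1/2 :: real) gchoose Suc k))\<bar> = \<bar>(1/2 :: real) gchoose Suc k\<bar>"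
      by (simp add: abs_mult)
    ultimately show ?thesis by linarith
  qed
  have "summable (\<lambda>k. \<bar>(1/2 :: real) gchoose Suc k\<bar>)"
  proof (rule summableI_nonneg_bounded[where x = 1])
    fix n
    have "(\<Sum>k\<le>n. (-1) ^ k * ((1/2 :: real) gchoose k)) = (-1) ^ n * ((-1/2) gchoose n)"
      using gbinomial_sum_lower_neg[of "1/2 :: real" n] by (simp add: mult.commute)
    also have "(\<Sum>k\<le>n. (-1) ^ k * ((1/2 :: real) gchoose k))
        = 1 + (\<Sum>k<n. (-1) ^ Suc k * ((1/2) gchoose Suc k))"
      by (subst sum.atMost_shift) simp
    finally have "(\<Sum>k<n. \<bar>(1/2 :: real) gchoose Suc k\<bar>) = 1 - (-1) ^ n * ((-1/2) gchoose n)"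
      unfolding abs_eq by (simp add: sum_negf)
    then show "(\<Sum>k<n. \<bar>(1/2 :: real) gchoose Suc k\<bar>) \<le> 1" using sgn[of n] by linarith
  qed simp
  then show ?thesis by (subst (asm) summable_Suc_iff)
qed

section \<open>Square roots inside a closed star-subalgebra\<close>

lemma star_scaleR: "star (r *\<^sub>R x) = r *\<^sub>R star (x :: 'a :: cstar_algebra)"
  by (simp add: scaleR_scaleC star_scaleC)

lemma star_sum: "star (sum f I) = (\<Sum>i\<in>I. star (f i :: 'a :: cstar_algebra))"
  by (induction I rule: infinite_finite_induct) (simp_all add: star_add)

lemma star_power: "star (x ^ n) = star (x :: 'a :: cstar_algebra) ^ n"
  by (induction n) (simp_all add: star_mult power_commutes)

lemma bounded_linear_star: "bounded_linear (star :: 'a :: cstar_algebra \<Rightarrow> 'a)"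
  by (rule bounded_linear_intro[of _ 1]) (simp_all add: star_add star_scaleR)

lemma cstar_subalgebraD:
  assumes "cstar_subalgebra A"
  shows "closed A" "0 \<in> A" "x \<in> A \<Longrightarrow> y \<in> A \<Longrightarrow> x + y \<in> A" "x \<in> A \<Longrightarrow> c *\<^sub>C x \<in> A"
    "x \<in> A \<Longrightarrow> y \<in> A \<Longrightarrow> x * y \<in> A" "x \<in> A \<Longrightarrow> star x \<in> A" "x \<in> A \<Longrightarrow> r *\<^sub>R x \<in> A"
  using assms by (auto simp: cstar_subalgebra_def scaleR_scaleC)

lemma cstar_subalgebra_sum:
  assumes "cstar_subalgebra A" "\<And>i. i \<in> I \<Longrightarrow> f i \<in> A"
  shows "sum f I \<in> A"
  using assms(2) by (induction I rule: infinite_finite_induct) (auto intro: cstar_subalgebraD[OF assms(1)])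

text \<open>With \<open>t = x - 1\<close>, the series of \<open>(1 + t)\<close> to the power 1/2
  converges absolutely because \<open>norm t \<le> 1\<close>. Its coefficients are real, so its sum
  is self-adjoint. Its partial sums are polynomials in \<open>t\<close>, so its sum stays in the
  closed algebra \<open>A\<close>.\<close>

lemma self_adjoint_sqrt:
  fixes x :: "'a :: cstar_algebra"
  assumes A: "cstar_subalgebra A" "1 \<in> A" and x: "x \<in> A" "star x = x" "norm (1 - x) \<le> 1"
  shows "\<exists>z\<in>A. star z = z \<and> z * z = x"
proof -
  define t where "t = x - 1"
  have t: "norm t \<le> 1" "star t = t" using x by (simp_all add: t_def norm_minus_commute star_diff)
  define a where "a k = ((1/2 :: real) gchoose k) *\<^sub>R t ^ k" for k
  have norm_a: "norm (a k) \<le> \<bar>1/2 gchoose k\<bar>" for k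
  proof -
    have "norm (t ^ k) \<le> norm t ^ k" by (rule norm_power_ineq)
    also have "\<dots> \<le> 1" using t(1) by (simp add: power_le_one)
    finally show ?thesis using mult_left_mono[of "norm (t ^ k)" 1 "\<bar>1/2 gchoose k\<bar>"] by (simp add: a_def)
  qed
  have sum_norm: "summable (\<lambda>k. norm (a k))"
    by (rule summable_comparison_test'[OF summable_abs_gbinomial_half, of 0]) (use norm_a in simp)
  have sum_a: "summable a" by (rule summable_norm_cancel[OF sum_norm])
  define z where "z = suminf a"
  have "(\<lambda>k. \<Sum>i\<le>k. a i * a (k - i)) sums (z * z)"
    unfolding z_def by (rule Cauchy_product_sums[OF sum_norm sum_norm])
  \<comment> \<open>Vandermonde's identity: squaring the series adds the exponents 1/2 + 1/2 =
    1.\<close>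
  moreover have "(\<Sum>i\<le>k. a i * a (k - i)) = (1 gchoose k) *\<^sub>R t ^ k" for k
  proof -
    have "(\<Sum>i\<le>k. a i * a (k - i)) = (\<Sum>i\<le>k. ((1/2 gchoose i) * (1/2 gchoose (k - i))) *\<^sub>R t ^ k)"
      by (rule sum.cong) (auto simp: a_def power_add[symmetric] mult.commute)
    also have "\<dots> = (\<Sum>i\<le>k. (1/2 gchoose i) * (1/2 gchoose (k - i))) *\<^sub>R t ^ k"
      by (rule scaleR_left.sum[symmetric])
    also have "(\<Sum>i\<le>k. (1/2 gchoose i) * (1/2 gchoose (k - i))) = (1 gchoose k :: real)"
      using gbinomial_Vandermonde[of "1/2 :: real" "1/2" k] by (simp add: atLeast0AtMost)
    finally show ?thesis .
  qed
  ultimately have "(\<lambda>k. (1 gchoose k :: real) *\<^sub>R t ^ k) sums (z * z)" by simp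
  \<comment> \<open>For exponent 1 only the terms 0 and 1 survive, so the square is
    \<open>1 + t = x\<close>.\<close>
  moreover have "(\<lambda>k. (1 gchoose k :: real) *\<^sub>R t ^ k) sums (\<Sum>k<2. (1 gchoose k :: real) *\<^sub>R t ^ k)"
  proof (rule sums_finite)
    fix k :: nat assume "k \<notin> {..<2}"
    then have "real (1 choose k) = 0" by (simp add: binomial_eq_0)
    moreover have "(1 gchoose k :: real) = real (1 choose k)"
      using binomial_gbinomial[of 1 k, where 'a = real] by simp
    ultimately show "(1 gchoose k :: real) *\<^sub>R t ^ k = 0" by (simp only: scaleR_zero_left)
  qed simp
  moreover have "(\<Sum>k<2. (1 gchoose k :: real) *\<^sub>R t ^ k) = x"
    by (simp add: numeral_2_eq_2 t_def)
  ultimately have zz: "z * z = x" using sums_unique2 by metis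
  have "star z = (\<Sum>k. star (a k))"
    unfolding z_def by (rule bounded_linear.suminf[OF bounded_linear_star sum_a])
  also have "(\<lambda>k. star (a k)) = a" by (simp add: a_def star_scaleR star_power t(2) fun_eq_iff)
  finally have "star z = z" by (simp add: z_def)
  moreover have "z \<in> A"
  proof -
    have "t = x + (-1) *\<^sub>R 1" by (simp add: t_def)
    then have tA: "t \<in> A" using x(1) A by (metis cstar_subalgebraD(3,7))
    have "t ^ k \<in> A" for k by (induction k) (auto intro: cstar_subalgebraD[OF A(1)] A(2) tA)
    then have "(\<Sum>k<n. a k) \<in> A" for n
      unfolding a_def by (intro cstar_subalgebra_sum[OF A(1)] cstar_subalgebraD(7)[OF A(1)])
    then show ?thesis
      unfolding z_def by (rule closed_sequentially[OF cstar_subalgebraD(1)[OF A(1)] _ summable_LIMSEQ[OF sum_a]])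
  qed
  ultimately show ?thesis using zz by blast
qed

section \<open>Square roots of positive elements of the Calkin algebra\<close>

text \<open>A Hilbert space computation replaces spectral theory: in the expansion of the squared
  norm of \<open>x - star T y\<close> with \<open>y = T x\<close>, the cross term contributes -2
  times the square of \<open>norm y\<close>, which outweighs the last term because
  \<open>star T\<close> is a contraction.\<close>

lemma norm_one_minus_star_mult_le:
  fixes T :: bop
  assumes "norm T \<le> 1"
  shows "norm (1 - star T * T) \<le> 1"
proof (rule norm_bop_bound)
  fix x
  define y where "y = bop_apply T x"
  have contr: "norm (bop_apply (star T) y) \<le> norm y"
    using norm_bop_apply[of "star T" y] mult_right_mono[OF assms, of "norm y"] by simp
  have in_eq: "inner (bop_apply (star T) y) x = (norm y)\<^sup>2"
    by (simp add: inner_ell2_def cinner_star y_def[symmetric] cinner_self)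
  have "(norm (x - bop_apply (star T) y))\<^sup>2
      = (norm x)\<^sup>2 - 2 * (norm y)\<^sup>2 + (norm (bop_apply (star T) y))\<^sup>2"
    using in_eq by (simp add: power2_norm_eq_inner inner_diff_left inner_diff_right
        inner_commute[of x "bop_apply (star T) y"])
  also have "\<dots> \<le> (norm x)\<^sup>2"
    using power_mono[OF contr norm_ge_zero, of 2] zero_le_power2[of "norm y"] by linarith
  finally have "norm (x - bop_apply (star T) y) \<le> norm x" by (rule power2_le_imp_le) simp
  then show "norm (bop_apply (1 - star T * T) x) \<le> 1 * norm x" by (simp add: y_def)
qed simp

lemma norm_calkin_proj_le: "norm (calkin_proj T) \<le> norm T"
  using qnorm_le[OF compact_op_zero, of T] by (simp add: norm_calkin_proj)

text \<open>Here \<open>y\<close> may lie outside \<open>A\<close>; only \<open>star y * y\<close>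
  has to belong to it. Lifting \<open>y\<close> to an operator and scaling it to a contraction gives
  the bound on \<open>norm (1 - x)\<close>, since the quotient map does not increase norms.\<close>

lemma calkin_sqrt:
  fixes y :: calkin
  assumes A: "cstar_subalgebra A" "1 \<in> A" and y: "star y * y \<in> A"
  shows "\<exists>z\<in>A. star z * z = star y * y"
proof -
  obtain T where T: "y = calkin_proj T" using calkin_proj_surj by blast
  \<comment> \<open>The summand 1 keeps the scaling factor positive even if
    \<open>T = 0\<close>.\<close>
  define r where "r = norm T + 1"
  have r: "r > 0" by (simp add: r_def add_nonneg_pos)
  define S where "S = (1 / r) *\<^sub>R T"
  have S: "norm S \<le> 1" using r by (simp add: S_def r_def)
  have y_eq: "y = r *\<^sub>R calkin_proj S" using r by (simp add: T S_def calkin_proj_simps)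
  define x where "x = star (calkin_proj S) * calkin_proj S"
  have x_eq: "star y * y = (r * r) *\<^sub>R x"
    by (simp add: y_eq x_def star_scaleR)
  have "x = (1 / (r * r)) *\<^sub>R (star y * y)" using r by (simp add: x_eq)
  then have xA: "x \<in> A" using cstar_subalgebraD(7)[OF A(1) y] by simp
  have "1 - x = calkin_proj (1 - star S * S)" by (simp add: x_def calkin_proj_simps)
  then have "norm (1 - x) \<le> 1"
    using norm_calkin_proj_le norm_one_minus_star_mult_le[OF S] order_trans by metis
  then obtain z where z: "z \<in> A" "star z = z" "z * z = x"
    using self_adjoint_sqrt[OF A xA] by (auto simp: x_def star_mult)
  have "star (r *\<^sub>R z) * (r *\<^sub>R z) = star y * y"
    by (simp add: x_eq star_scaleR z)
  then show ?thesis using cstar_subalgebraD(7)[OF A(1) z(1)] by blast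
qed

section \<open>Matrices over the Calkin algebra as elements of it\<close>

text \<open>From the two isometries \<open>v\<close>, \<open>w\<close> of the direct sum, the words
  \<open>w ^ i * v\<close> form an infinite sequence of isometries with orthogonal ranges, so one
  sequence serves matrices of every size.\<close>

definition calkin_isom :: "nat \<Rightarrow> calkin"
  where "calkin_isom i = calkin_proj (summand_isom 1) ^ i * calkin_proj (summand_isom 0)"

text \<open>Each induction step cancels one factor \<open>star w * w\<close>; unequal indices end in
  \<open>star v * w = 0\<close> or \<open>star w * v = 0\<close>.\<close>

lemma calkin_isom_orthonormal:
  "star (calkin_isom i) * calkin_isom j = (if i = j then 1 else 0)"
proof (induction i arbitrary: j)
  case 0
  show ?case
    by (cases j)
       (simp_all add: calkin_isom_def dsum_isom_calkin(1,3)[OF refl refl] mult.assoc[symmetric]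
         del: One_nat_def)
next
  case (Suc i)
  note rel = dsum_isom_calkin[OF refl refl]
  have step: "calkin_isom (Suc i) = calkin_proj (summand_isom 1) * calkin_isom i" for i
    by (simp add: calkin_isom_def mult.assoc)
  show ?case
  proof (cases j)
    case 0
    have "star (calkin_isom (Suc i)) * calkin_isom 0
        = star (calkin_isom i) * (star (calkin_proj (summand_isom 1)) * calkin_proj (summand_isom 0))"
      by (simp add: step star_mult mult.assoc) (simp add: calkin_isom_def)
    then show ?thesis using 0 rel(4) by simp
  next
    case (Suc j')
    have "star (calkin_isom (Suc i)) * calkin_isom (Suc j')
        = star (calkin_isom i) * (star (calkin_proj (summand_isom 1)) * calkin_proj (summand_isom 1)) * calkin_isom j'"
      by (simp add: step star_mult mult.assoc)
    then show ?thesis using Suc Suc.IH rel(2) by simp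
  qed
qed

lemma calkin_isom_orthonormal_assoc:
  "star (calkin_isom i) * (calkin_isom j * x) = (if i = j then x else 0)"
  by (simp add: mult.assoc[symmetric] calkin_isom_orthonormal)

text \<open>The products \<open>calkin_isom i * star (calkin_isom j)\<close> are matrix units, so
  this is a star-homomorphism from n by n matrices; the identity matrix goes to
  \<open>range_proj n\<close> below.\<close>

definition calkin_matrix :: "nat \<Rightarrow> (nat \<Rightarrow> nat \<Rightarrow> calkin) \<Rightarrow> calkin"
  where "calkin_matrix n x = (\<Sum>i<n. \<Sum>j<n. calkin_isom i * x i j * star (calkin_isom j))"

lemma calkin_matrix_cong:
  "(\<And>i j. i < n \<Longrightarrow> j < n \<Longrightarrow> x i j = y i j) \<Longrightarrow> calkin_matrix n x = calkin_matrix n y"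
  by (simp add: calkin_matrix_def)

lemma star_isom_calkin_matrix:
  assumes "i < n"
  shows "star (calkin_isom i) * calkin_matrix n x = (\<Sum>j<n. x i j * star (calkin_isom j))"
proof -
  have "star (calkin_isom i) * calkin_matrix n x
      = (\<Sum>k<n. if i = k then \<Sum>j<n. x k j * star (calkin_isom j) else 0)"
    unfolding calkin_matrix_def sum_distrib_left mult.assoc calkin_isom_orthonormal_assoc
    by (rule sum.cong) auto
  then show ?thesis using assms by simp
qed

lemma calkin_matrix_entry:
  assumes "i < n" "j < n"
  shows "star (calkin_isom i) * calkin_matrix n x * calkin_isom j = x i j"
proof -
  have "star (calkin_isom i) * calkin_matrix n x * calkin_isom j
      = (\<Sum>k<n. if j = k then x i k else 0)"
    unfolding star_isom_calkin_matrix[OF assms(1)] sum_distrib_right mult.assoc calkin_isom_orthonormal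
    by (rule sum.cong) auto
  then show ?thesis using assms by simp
qed

lemma star_calkin_matrix: "star (calkin_matrix n x) = calkin_matrix n (\<lambda>i j. star (x j i))"
  unfolding calkin_matrix_def star_sum by (subst sum.swap) (simp add: star_mult mult.assoc)

lemma calkin_matrix_mult:
  "calkin_matrix n x * calkin_matrix n y = calkin_matrix n (\<lambda>i j. \<Sum>k<n. x i k * y k j)"
proof -
  have "calkin_matrix n x * calkin_matrix n y
      = (\<Sum>i<n. \<Sum>k<n. calkin_isom i * x i k * (star (calkin_isom k) * calkin_matrix n y))"
    by (simp add: calkin_matrix_def[of n x] sum_distrib_right mult.assoc)
  also have "\<dots> = (\<Sum>i<n. \<Sum>k<n. \<Sum>j<n. calkin_isom i * (x i k * y k j) * star (calkin_isom j))"
    by (simp add: star_isom_calkin_matrix sum_distrib_left mult.assoc)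
  also have "\<dots> = (\<Sum>i<n. \<Sum>j<n. \<Sum>k<n. calkin_isom i * (x i k * y k j) * star (calkin_isom j))"
    by (intro sum.cong refl sum.swap)
  also have "\<dots> = calkin_matrix n (\<lambda>i j. \<Sum>k<n. x i k * y k j)"
    by (simp add: calkin_matrix_def sum_distrib_left sum_distrib_right)
  finally show ?thesis .
qed

section \<open>Corner entries and factorization of positive matrices\<close>

definition range_proj :: "nat \<Rightarrow> calkin"
  where "range_proj n = (\<Sum>i<n. calkin_isom i * star (calkin_isom i))"

lemma range_proj_eq_calkin_matrix: "range_proj n = calkin_matrix n (\<lambda>i j. if i = j then 1 else 0)"
  unfolding range_proj_def calkin_matrix_def
proof (rule sum.cong)
  fix i assume "i \<in> {..<n}"
  have "(\<Sum>j<n. calkin_isom i * (if i = j then 1 else 0) * star (calkin_isom j))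
      = (\<Sum>j<n. if i = j then calkin_isom i * star (calkin_isom j) else 0)"
    by (rule sum.cong) auto
  then show "calkin_isom i * star (calkin_isom i)
      = (\<Sum>j<n. calkin_isom i * (if i = j then 1 else 0) * star (calkin_isom j))"
    using \<open>i \<in> {..<n}\<close> by simp
qed simp

lemma range_proj_commute_calkin_matrix:
  "range_proj n * calkin_matrix n x = calkin_matrix n x * range_proj n"
  unfolding range_proj_eq_calkin_matrix calkin_matrix_mult
  by (rule calkin_matrix_cong) (simp add: if_distrib if_distribR cong: if_cong)

lemma star_range_proj: "star (range_proj n) = range_proj n"
  by (simp add: range_proj_def star_sum star_mult)

lemma range_proj_isom: "j < n \<Longrightarrow> range_proj n * calkin_isom j = calkin_isom j"
  by (simp add: range_proj_def sum_distrib_right mult.assoc calkin_isom_orthonormal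
      if_distrib cong: if_cong)

text \<open>The corner entries multiply like matrices: \<open>range_proj n\<close> fixes
  \<open>calkin_isom j\<close>, and commutation with \<open>b\<close> moves it between
  \<open>a\<close> and \<open>b\<close>, where it expands into the sum over
  \<open>k\<close>.\<close>

lemma compress_mult:
  assumes "range_proj n * b = b * range_proj n" "j < n"
  shows "star (calkin_isom i) * (a * b) * calkin_isom j
    = (\<Sum>k<n. (star (calkin_isom i) * a * calkin_isom k) * (star (calkin_isom k) * b * calkin_isom j))"
proof -
  have "star (calkin_isom i) * (a * b) * calkin_isom j
      = star (calkin_isom i) * a * (b * range_proj n) * calkin_isom j"
    by (simp add: mult.assoc range_proj_isom assms(2))
  also have "\<dots> = star (calkin_isom i) * a * (range_proj n * b) * calkin_isom j"
    by (simp only: assms(1))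
  also have "\<dots> = (\<Sum>k<n. (star (calkin_isom i) * a * calkin_isom k) * (star (calkin_isom k) * b * calkin_isom j))"
    by (simp add: range_proj_def sum_distrib_left sum_distrib_right mult.assoc)
  finally show ?thesis .
qed

text \<open>The image of the matrices over \<open>A\<close> has unit \<open>range_proj n\<close>,
  not 1, whereas the square root lemma wants 1 in the algebra. Asking only for commutation with
  \<open>range_proj n\<close> and for corner entries in \<open>A\<close> admits 1 and leaves the
  complementary corner free.\<close>

definition compress_algebra :: "calkin set \<Rightarrow> nat \<Rightarrow> calkin set"
  where "compress_algebra A n = {m. range_proj n * m = m * range_proj n \<and>
    (\<forall>i<n. \<forall>j<n. star (calkin_isom i) * m * calkin_isom j \<in> A)}"

lemma cstar_subalgebra_compress_algebra:
  assumes A: "cstar_subalgebra A"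
  shows "cstar_subalgebra (compress_algebra A n)"
  unfolding cstar_subalgebra_def
proof (intro conjI ballI allI)
  have "closed ((\<lambda>m. star (calkin_isom i) * m * calkin_isom j) -` A)" for i j
    by (intro continuous_closed_vimage cstar_subalgebraD(1)[OF A]) (intro continuous_intros)
  then have "closed ({m. range_proj n * m = m * range_proj n} \<inter>
      (\<Inter>i\<in>{..<n}. \<Inter>j\<in>{..<n}. (\<lambda>m. star (calkin_isom i) * m * calkin_isom j) -` A))"
    by (intro closed_Int closed_INT ballI closed_Collect_eq continuous_intros) auto
  also have "\<dots> = compress_algebra A n" by (auto simp: compress_algebra_def)
  finally show "closed (compress_algebra A n)" .
  show "0 \<in> compress_algebra A n"
    by (simp add: compress_algebra_def cstar_subalgebraD[OF A])
next
  fix x y assume "x \<in> compress_algebra A n" "y \<in> compress_algebra A n"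
  then have x: "range_proj n * x = x * range_proj n" "\<And>i j. i < n \<Longrightarrow> j < n \<Longrightarrow> star (calkin_isom i) * x * calkin_isom j \<in> A"
    and y: "range_proj n * y = y * range_proj n" "\<And>i j. i < n \<Longrightarrow> j < n \<Longrightarrow> star (calkin_isom i) * y * calkin_isom j \<in> A"
    by (auto simp: compress_algebra_def)
  show "x + y \<in> compress_algebra A n"
    using x y by (auto simp: compress_algebra_def distrib_left distrib_right intro: cstar_subalgebraD[OF A])
  have "range_proj n * (x * y) = (x * y) * range_proj n"
    by (metis x(1) y(1) mult.assoc)
  moreover have "star (calkin_isom i) * (x * y) * calkin_isom j \<in> A" if "i < n" "j < n" for i j
    unfolding compress_mult[OF y(1) that(2)]
    by (intro cstar_subalgebra_sum[OF A] cstar_subalgebraD(5)[OF A x(2) y(2)]) (use that in auto)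
  ultimately show "x * y \<in> compress_algebra A n" by (simp add: compress_algebra_def)
next
  fix c x assume "x \<in> compress_algebra A n"
  then show "c *\<^sub>C x \<in> compress_algebra A n"
    by (auto simp: compress_algebra_def mult_scaleC_left mult_scaleC_right intro: cstar_subalgebraD[OF A])
next
  fix x assume "x \<in> compress_algebra A n"
  then have x: "range_proj n * x = x * range_proj n" "\<And>i j. i < n \<Longrightarrow> j < n \<Longrightarrow> star (calkin_isom i) * x * calkin_isom j \<in> A"
    by (auto simp: compress_algebra_def)
  have "range_proj n * star x = star x * range_proj n"
    using arg_cong[OF x(1), of star] by (simp add: star_mult star_range_proj)
  moreover have "star (calkin_isom i) * star x * calkin_isom j \<in> A" if "i < n" "j < n" for i j
    using cstar_subalgebraD(6)[OF A x(2)[OF that(2,1)]] by (simp add: star_mult mult.assoc)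
  ultimately show "star x \<in> compress_algebra A n" by (simp add: compress_algebra_def)
qed

text \<open>Positivity supplies a factor \<open>y\<close> with entries anywhere in the Calkin
  algebra. Encoding matrices as single elements lets \<open>calkin_sqrt\<close>, applied in
  \<open>compress_algebra A n\<close>, replace it by a factor over \<open>A\<close>, where a
  homomorphism defined on \<open>A\<close> can act.\<close>

lemma positive_matrix_in_subalgebra:
  fixes x :: "nat \<Rightarrow> nat \<Rightarrow> calkin"
  assumes A: "cstar_subalgebra A" "1 \<in> A"
    and x: "\<And>i j. i < n \<Longrightarrow> j < n \<Longrightarrow> x i j \<in> A" and pos: "positive_matrix n x"
  shows "\<exists>z. (\<forall>i<n. \<forall>j<n. z i j \<in> A) \<and> (\<forall>i<n. \<forall>j<n. x i j = (\<Sum>k<n. star (z k i) * z k j))"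
proof -
  obtain y where y: "\<And>i j. i < n \<Longrightarrow> j < n \<Longrightarrow> x i j = (\<Sum>k<n. star (y k i) * y k j)"
    using pos by (auto simp: positive_matrix_def)
  have yx: "star (calkin_matrix n y) * calkin_matrix n y = calkin_matrix n x"
    unfolding star_calkin_matrix calkin_matrix_mult by (rule calkin_matrix_cong) (simp add: y)
  have "calkin_matrix n x \<in> compress_algebra A n"
    by (simp add: compress_algebra_def range_proj_commute_calkin_matrix calkin_matrix_entry x)
  moreover have "1 \<in> compress_algebra A n"
    by (simp add: compress_algebra_def calkin_isom_orthonormal A cstar_subalgebraD)
  ultimately obtain z where z: "z \<in> compress_algebra A n" "star z * z = calkin_matrix n x"
    using calkin_sqrt[OF cstar_subalgebra_compress_algebra[OF A(1)], of n "calkin_matrix n y"] yx by metis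
  \<comment> \<open>The root \<open>z\<close> need not be supported in the corner; as it commutes
    with \<open>range_proj n\<close>, its corner entries alone already give the
    factorization.\<close>
  define w where "w i j = star (calkin_isom i) * z * calkin_isom j" for i j
  have "x i j = (\<Sum>k<n. star (w k i) * w k j)" if "i < n" "j < n" for i j
  proof -
    have "x i j = star (calkin_isom i) * (star z * z) * calkin_isom j"
      by (simp add: z(2) calkin_matrix_entry that)
    also have "\<dots> = (\<Sum>k<n. (star (calkin_isom i) * star z * calkin_isom k) * (star (calkin_isom k) * z * calkin_isom j))"
      using z(1) that by (intro compress_mult) (auto simp: compress_algebra_def)
    also have "\<dots> = (\<Sum>k<n. star (w k i) * w k j)"
      by (simp add: w_def star_mult mult.assoc)
    finally show ?thesis .
  qed
  moreover have "\<forall>i<n. \<forall>j<n. w i j \<in> A" using z(1) by (simp add: compress_algebra_def w_def)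
  ultimately show ?thesis by blast
qed

section \<open>Compressions of star-homomorphisms\<close>

lemma unital_star_hom_on_sum:
  assumes f: "unital_star_hom_on A f" and A: "cstar_subalgebra A" and g: "\<And>i. i \<in> I \<Longrightarrow> g i \<in> A"
  shows "f (sum g I) = (\<Sum>i\<in>I. f (g i))"
proof -
  have "f 0 = 0" using f cstar_subalgebraD(2)[OF A] unfolding unital_star_hom_on_def
    by (metis add_cancel_right_right)
  then show ?thesis using g
    by (induction I rule: infinite_finite_induct)
       (use f cstar_subalgebra_sum[OF A, of _ g] in \<open>auto simp: unital_star_hom_on_def\<close>)
qed

text \<open>The easy direction of Stinespring's theorem: a factorization of \<open>x\<close> through
  \<open>z\<close> over \<open>A\<close> is carried by \<open>\<rho>\<close> to one of the
  compressed matrix, with factor \<open>\<rho> (z i j) * v\<close>.\<close>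

lemma ucp_on_compression:
  fixes \<rho> :: "calkin \<Rightarrow> 'b :: cstar_algebra"
  assumes A: "cstar_subalgebra A" "1 \<in> A" and S: "S \<subseteq> A"
    and \<rho>: "unital_star_hom_on A \<rho>" and v: "star v * v = 1"
  shows "ucp_on S (\<lambda>a. star v * \<rho> a * v)"
  unfolding ucp_on_def
proof (intro conjI ballI allI impI)
  show "star v * \<rho> 1 * v = 1" using \<rho> v by (simp add: unital_star_hom_on_def)
  show "star v * \<rho> (x + y) * v = star v * \<rho> x * v + star v * \<rho> y * v" if "x \<in> S" "y \<in> S" for x y
    using \<rho> that S by (auto simp: unital_star_hom_on_def subset_iff distrib_left distrib_right)
  show "star v * \<rho> (c *\<^sub>C x) * v = c *\<^sub>C (star v * \<rho> x * v)" if "x \<in> S" for c x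
    using \<rho> that S by (auto simp: unital_star_hom_on_def subset_iff mult_scaleC_left mult_scaleC_right)
  fix n x assume x: "\<forall>i<n. \<forall>j<n. x i j \<in> S" and pos: "positive_matrix n x"
  have xA: "x i j \<in> A" if "i < n" "j < n" for i j using x that S by blast
  obtain z where z: "\<And>i j. i < n \<Longrightarrow> j < n \<Longrightarrow> z i j \<in> A"
    "\<And>i j. i < n \<Longrightarrow> j < n \<Longrightarrow> x i j = (\<Sum>k<n. star (z k i) * z k j)"
    using positive_matrix_in_subalgebra[OF A xA pos] by blast
  have "star v * \<rho> (x i j) * v = (\<Sum>k<n. star (\<rho> (z k i) * v) * (\<rho> (z k j) * v))"
    if ij: "i < n" "j < n" for i j
  proof -
    have "\<rho> (x i j) = (\<Sum>k<n. \<rho> (star (z k i) * z k j))"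
      unfolding z(2)[OF ij]
      by (rule unital_star_hom_on_sum[OF \<rho> A(1)]) (use z(1) ij in \<open>auto intro: cstar_subalgebraD[OF A(1)]\<close>)
    also have "\<dots> = (\<Sum>k<n. star (\<rho> (z k i)) * \<rho> (z k j))"
      using \<rho> z(1) ij cstar_subalgebraD(6)[OF A(1)] by (intro sum.cong) (auto simp: unital_star_hom_on_def)
    finally show ?thesis by (simp add: sum_distrib_left sum_distrib_right star_mult mult.assoc)
  qed
  then show "positive_matrix n (\<lambda>i j. star v * \<rho> (x i j) * v)"
    unfolding positive_matrix_def by (intro exI[of _ "\<lambda>i j. \<rho> (z i j) * v"]) simp
qed

section \<open>From an inverse in Ext to a ucp lift\<close>

theorem theorem1p1:
  fixes R :: "bop set"
  assumes "operator_system R"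
    and "separable_space (top_of_set (cstar_generated (calkin_proj ` R)))"
    and "Ext_invertible (cstar_generated (calkin_proj ` R))
           (Ext_class (cstar_generated (calkin_proj ` R)) (\<lambda>a. a))"
  shows "smith_ward R"
proof -
  define A where "A = cstar_generated (calkin_proj ` R)"
  have A: "cstar_subalgebra A" "calkin_proj ` R \<subseteq> A"
    by (simp_all add: A_def cstar_subalgebra_generated cstar_generated_superset)
  have "1 \<in> R" using assms(1) by (simp add: operator_system_def)
  then have one: "1 \<in> A" using A(2) calkin_proj_simps(8) by (metis image_subset_iff)
  obtain d where d: "d \<in> Ext A" "Ext_add A (Ext_class A (\<lambda>a. a)) d = Ext_zero A"
    using assms(3) by (auto simp: Ext_invertible_def A_def)
  obtain \<tau> where \<tau>: "extension A \<tau>" "d = Ext_class A \<tau>"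
    using d(1) by (auto simp: Ext_def Ext_class_def elim: quotientE)
  \<comment> \<open>The direct sum lies in its own class, which equals \<open>Ext_zero A\<close>;
    hence this very representative lifts, with no further unitary conjugation.\<close>
  have "ext_dsum (\<lambda>a. a) \<tau> \<in> Ext_class A (ext_dsum (\<lambda>a. a) \<tau>)"
    unfolding Ext_class_def
    by (rule equiv_class_self[OF equiv_ext_rel]) (simp add: extension_dsum extension_inclusion \<tau>(1))
  also have "\<dots> = Ext_zero A"
    using d(2) Ext_add_class[OF extension_inclusion \<tau>(1)] by (simp add: \<tau>(2))
  finally obtain \<rho> :: "calkin \<Rightarrow> bop" where \<rho>: "unital_star_hom_on A \<rho>"
    "\<And>a. a \<in> A \<Longrightarrow> calkin_proj (\<rho> a) = ext_dsum (\<lambda>a. a) \<tau> a"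
    by (auto simp: Ext_zero_def)
  define v where "v = summand_isom 0"
  \<comment> \<open>Compressing the direct sum by the first isometry kills the \<open>\<tau>\<close>
    summand by orthogonality of the ranges and returns \<open>a\<close>.\<close>
  have "calkin_proj (star v * \<rho> a * v) = a" if "a \<in> A" for a
  proof -
    note rel = dsum_isom_calkin[OF refl refl]
    have rel': "star (calkin_proj (summand_isom 0)) * (calkin_proj (summand_isom 0) * z) = z"
      "star (calkin_proj (summand_isom 0)) * (calkin_proj (summand_isom 1) * z) = 0" for z
      by (simp_all only: mult.assoc[symmetric] rel mult_1_left mult_zero_left)
    show ?thesis
      by (simp add: calkin_proj_simps v_def \<rho>(2) that ext_dsum_def calkin_dsum_def
          distrib_left distrib_right mult.assoc rel rel' del: One_nat_def)
  qed
  then have "\<forall>y\<in>calkin_proj ` R. calkin_proj (star v * \<rho> y * v) = y"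
    using A(2) by blast
  moreover have "ucp_on (calkin_proj ` R) (\<lambda>a. star v * \<rho> a * v)"
    using A one \<rho>(1) summand_isom_relations(1) by (intro ucp_on_compression) (auto simp: v_def)
  ultimately show ?thesis unfolding smith_ward_def by blast
qed

end
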